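(* Let $M^n=N_T\times_f N_\perp$ be a contact $CR$-warped product submanifold of a cosymplectic manifold $\tilde M$, with the characteristic vector field $\xi$ tangent to $N_T$. Then $M^n$ is $\mathcal{D}_T$-minimal in $\tilde M$.
   Context: An almost contact metric manifold is an odd-dimensional Riemannian manifold $(\tilde M,g)$ with a $(1,1)$-tensor field $\phi$, a unit vector field $\xi$ (the characteristic vector field) and the dual 1-form $\eta=g(\cdot,\xi)$ such that $\phi^2=-I+\eta\otimes\xi$, $\phi\xi=0$, $\eta\circ\phi=0$, $g(\phi X,\phi Y)=g(X,Y)-\eta(X)\eta(Y)$. It is cosymplectic if $\tilde\nabla\phi=0$ for the Levi-Civita connection $\tilde\nabla$ (hence $\tilde\nabla\xi=0$). The warped product $N_1\times_f N_2$ of Riemannian manifolds $(N_1,g_1)$, $(N_2,g_2)$ with smooth $f:N_1\to(0,\infty)$ is $N_1\times N_2$ with the metric $g_1+f^2g_2$. A contact $CR$-warped product submanifold $M^n=N_T\times_f N_\perp$ of $\tilde M$ is a warped product isometrically immersed in $\tilde M$ such that $\xi$ is tangent to $N_T$, $N_T$ is invariant ($\phi(TN_T)\subseteq TN_T$) and $N_\perp$ is anti-invariant ($\phi(TN_\perp)\subseteq T^\perp M$, the normal bundle of $M$). Let $\mathcal{D}_T$ be the distribution on $M$ tangent to the factor $N_T$ and $h$ the second fundamental form of $M$ in $\tilde M$. $M$ is called $\mathcal{D}_T$-minimal if $\sum_{i=1}^{n_1}h(e_i,e_i)=0$ for every local orthonormal frame $\{e_1,\dots,e_{n_1}\}$ of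 $\mathcal{D}_T$, where $n_1=\dim N_T$. *)

theory Defs
  imports "HOL-Analysis.Analysis"
begin

section \<open>Smooth manifolds\<close>

text \<open>Intended for open \<open>S\<close>: all derivatives are taken in the full space.\<close>

fun times_differentiable_on ::
    "nat \<Rightarrow> 'a::real_normed_vector set \<Rightarrow> ('a \<Rightarrow> 'b::real_normed_vector) \<Rightarrow> bool" where
  "times_differentiable_on 0 S f \<longleftrightarrow> continuous_on S f"
| "times_differentiable_on (Suc k) S f \<longleftrightarrow>
     (\<forall>x\<in>S. f differentiable (at x)) \<and>
     (\<forall>v. times_differentiable_on k S (\<lambda>x. frechet_derivative f (at x) v))"

definition smooth_on :: "'a::real_normed_vector set \<Rightarrow> ('a \<Rightarrow> 'b::real_normed_vector) \<Rightarrow> bool" where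
  "smooth_on S f \<longleftrightarrow> (\<forall>k. times_differentiable_on k S f)"

record ('a, 'e) chart =
  chart_dom :: "'a set"
  chart_map :: "'a \<Rightarrow> 'e"

definition chart_inv :: "('a, 'e) chart \<Rightarrow> 'e \<Rightarrow> 'a" where
  "chart_inv c = inv_into (chart_dom c) (chart_map c)"

definition is_chart :: "('a::topological_space, 'e::euclidean_space) chart \<Rightarrow> bool" where
  "is_chart c \<longleftrightarrow> open (chart_dom c) \<and> open (chart_map c ` chart_dom c) \<and>
     homeomorphism (chart_dom c) (chart_map c ` chart_dom c) (chart_map c) (chart_inv c)"

text \<open>
  The points of a manifold are all elements of the type \<open>'a\<close>, and its dimension is \<open>DIM('e)\<close>.
  Besides the atlas, a manifold carries a chosen chart \<open>chart_at M p\<close> around every point \<open>p\<close>.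
  It serves only to represent the tangent space at \<open>p\<close>: the vector \<open>v :: 'e\<close> at \<open>p\<close> stands for
  the tangent vector with components \<open>v\<close> in the chart \<open>chart_at M p\<close>.  Thus every tangent space
  is a copy of \<open>'e\<close>, and a vector field is a function \<open>'a \<Rightarrow> 'e\<close> whose value at \<open>p\<close> is to be read
  in the chosen chart at \<open>p\<close>.
\<close>

record ('a, 'e) manifold =
  atlas :: "('a, 'e) chart set"
  chart_at :: "'a \<Rightarrow> ('a, 'e) chart"

locale smooth_manifold =
  fixes M :: "('a::{t2_space,second_countable_topology}, 'e::euclidean_space) manifold"
  assumes charts: "c \<in> atlas M \<Longrightarrow> is_chart c"
    and transition_smooth: "c \<in> atlas M \<Longrightarrow> d \<in> atlas M \<Longrightarrow>
      smooth_on (chart_map c ` (chart_dom c \<inter> chart_dom d)) (chart_map d \<circ> chart_inv c)"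
    and chart_at_atlas: "chart_at M p \<in> atlas M"
    and chart_at_dom: "p \<in> chart_dom (chart_at M p)"

text \<open>Components in the chart \<open>c\<close> of the tangent vector \<open>v\<close> at \<open>p\<close>, and the inverse operation.\<close>

definition to_chart ::
    "('a, 'e::euclidean_space) manifold \<Rightarrow> ('a, 'e) chart \<Rightarrow> 'a \<Rightarrow> 'e \<Rightarrow> 'e" where
  "to_chart M c p v = frechet_derivative (chart_map c \<circ> chart_inv (chart_at M p))
     (at (chart_map (chart_at M p) p)) v"

definition from_chart ::
    "('a, 'e::euclidean_space) manifold \<Rightarrow> ('a, 'e) chart \<Rightarrow> 'a \<Rightarrow> 'e \<Rightarrow> 'e" where
  "from_chart M c p w = frechet_derivative (chart_map (chart_at M p) \<circ> chart_inv c)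
     (at (chart_map c p)) w"

definition smooth_fun_on ::
    "('a, 'e::euclidean_space) manifold \<Rightarrow> 'a set \<Rightarrow> ('a \<Rightarrow> 'v::real_normed_vector) \<Rightarrow> bool" where
  "smooth_fun_on M U f \<longleftrightarrow>
     (\<forall>c\<in>atlas M. smooth_on (chart_map c ` (chart_dom c \<inter> U)) (f \<circ> chart_inv c))"

definition smooth_vector_field_on ::
    "('a, 'e::euclidean_space) manifold \<Rightarrow> 'a set \<Rightarrow> ('a \<Rightarrow> 'e) \<Rightarrow> bool" where
  "smooth_vector_field_on M U X \<longleftrightarrow>
     (\<forall>c\<in>atlas M. smooth_on (chart_map c ` (chart_dom c \<inter> U))
        ((\<lambda>q. to_chart M c q (X q)) \<circ> chart_inv c))"

definition smooth_map ::
    "('a::topological_space, 'e::euclidean_space) manifold \<Rightarrow>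
     ('b::topological_space, 'f::euclidean_space) manifold \<Rightarrow> ('a \<Rightarrow> 'b) \<Rightarrow> bool" where
  "smooth_map M N F \<longleftrightarrow> continuous_on UNIV F \<and>
     (\<forall>c\<in>atlas M. \<forall>d\<in>atlas N.
        smooth_on (chart_map c ` (chart_dom c \<inter> F -` chart_dom d))
          (chart_map d \<circ> F \<circ> chart_inv c))"

text \<open>\<open>dir_deriv M f p v\<close> is the derivative of the function \<open>f\<close> at \<open>p\<close> along the tangent vector
  \<open>v\<close>; \<open>differential M N F p\<close> is the tangent map of \<open>F\<close> at \<open>p\<close>.\<close>

definition dir_deriv ::
    "('a, 'e::euclidean_space) manifold \<Rightarrow> ('a \<Rightarrow> 'v::real_normed_vector) \<Rightarrow> 'a \<Rightarrow> 'e \<Rightarrow> 'v" where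
  "dir_deriv M f p v =
     frechet_derivative (f \<circ> chart_inv (chart_at M p)) (at (chart_map (chart_at M p) p)) v"

definition differential ::
    "('a, 'e::euclidean_space) manifold \<Rightarrow> ('b, 'f::euclidean_space) manifold \<Rightarrow>
     ('a \<Rightarrow> 'b) \<Rightarrow> 'a \<Rightarrow> 'e \<Rightarrow> 'f" where
  "differential M N F p v =
     frechet_derivative (chart_map (chart_at N (F p)) \<circ> F \<circ> chart_inv (chart_at M p))
       (at (chart_map (chart_at M p) p)) v"

text \<open>\<open>[X, Y]\<^sup>k = \<Sum>\<^sub>j X\<^sup>j \<partial>\<^sub>j Y\<^sup>k - Y\<^sup>j \<partial>\<^sub>j X\<^sup>k\<close>, in the chosen chart at \<open>p\<close>.\<close>

definition lie_bracket ::
    "('a, 'e::euclidean_space) manifold \<Rightarrow> ('a \<Rightarrow> 'e) \<Rightarrow> ('a \<Rightarrow> 'e) \<Rightarrow> 'a \<Rightarrow> 'e" where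
  "lie_bracket M X Y p =
     dir_deriv M (\<lambda>q. to_chart M (chart_at M p) q (Y q)) p (X p) -
     dir_deriv M (\<lambda>q. to_chart M (chart_at M p) q (X q)) p (Y p)"

definition prod_chart :: "('a, 'e) chart \<Rightarrow> ('b, 'f) chart \<Rightarrow> ('a \<times> 'b, 'e \<times> 'f) chart" where
  "prod_chart c d = \<lparr>chart_dom = chart_dom c \<times> chart_dom d,
                     chart_map = map_prod (chart_map c) (chart_map d)\<rparr>"

definition prod_manifold ::
    "('a, 'e) manifold \<Rightarrow> ('b, 'f) manifold \<Rightarrow> ('a \<times> 'b, 'e \<times> 'f) manifold" where
  "prod_manifold M N = \<lparr>atlas = {prod_chart c d | c d. c \<in> atlas M \<and> d \<in> atlas N},
     chart_at = (\<lambda>(p, q). prod_chart (chart_at M p) (chart_at N q))\<rparr>"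


section \<open>Riemannian manifolds\<close>

text \<open>Smoothness of a tensor field is expressed by its action on smooth local vector fields.\<close>

locale riemannian_manifold = smooth_manifold M
  for M :: "('a::{t2_space,second_countable_topology}, 'e::euclidean_space) manifold" +
  fixes g :: "'a \<Rightarrow> 'e \<Rightarrow> 'e \<Rightarrow> real"
  assumes metric_bilinear: "bilinear (g p)"
    and metric_sym: "g p v w = g p w v"
    and metric_pos: "v \<noteq> 0 \<Longrightarrow> g p v v > 0"
    and metric_smooth: "open U \<Longrightarrow> smooth_vector_field_on M U X \<Longrightarrow> smooth_vector_field_on M U Y \<Longrightarrow>
      smooth_fun_on M U (\<lambda>p. g p (X p) (Y p))"

text \<open>\<open>nab p v Y\<close> is the covariant derivative at \<open>p\<close> of the local vector field \<open>Y\<close> along the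
  tangent vector \<open>v\<close>.  The conditions concern only fields \<open>Y\<close> that are smooth near \<open>p\<close>, and
  determine \<open>nab p v Y\<close> uniquely for those.\<close>

locale levi_civita_connection = riemannian_manifold M g
  for M :: "('a::{t2_space,second_countable_topology}, 'e::euclidean_space) manifold"
    and g :: "'a \<Rightarrow> 'e \<Rightarrow> 'e \<Rightarrow> real" +
  fixes nab :: "'a \<Rightarrow> 'e \<Rightarrow> ('a \<Rightarrow> 'e) \<Rightarrow> 'e"
  assumes connection_linear: "open U \<Longrightarrow> p \<in> U \<Longrightarrow> smooth_vector_field_on M U Y \<Longrightarrow>
      linear (\<lambda>v. nab p v Y)"
    and connection_smooth: "open U \<Longrightarrow> smooth_vector_field_on M U X \<Longrightarrow>
      smooth_vector_field_on M U Y \<Longrightarrow> smooth_vector_field_on M U (\<lambda>q. nab q (X q) Y)"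
    and connection_add: "open U \<Longrightarrow> p \<in> U \<Longrightarrow> smooth_vector_field_on M U Y \<Longrightarrow>
      smooth_vector_field_on M U Z \<Longrightarrow> nab p v (\<lambda>q. Y q + Z q) = nab p v Y + nab p v Z"
    and connection_Leibniz: "open U \<Longrightarrow> p \<in> U \<Longrightarrow> smooth_fun_on M U f \<Longrightarrow>
      smooth_vector_field_on M U Y \<Longrightarrow>
      nab p v (\<lambda>q. f q *\<^sub>R Y q) = dir_deriv M f p v *\<^sub>R Y p + f p *\<^sub>R nab p v Y"
    and torsion_free: "open U \<Longrightarrow> p \<in> U \<Longrightarrow> smooth_vector_field_on M U X \<Longrightarrow>
      smooth_vector_field_on M U Y \<Longrightarrow> nab p (X p) Y - nab p (Y p) X = lie_bracket M X Y p"
    and metric_compatible: "open U \<Longrightarrow> p \<in> U \<Longrightarrow> smooth_vector_field_on M U Y \<Longrightarrow>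
      smooth_vector_field_on M U Z \<Longrightarrow>
      dir_deriv M (\<lambda>q. g q (Y q) (Z q)) p v = g p (nab p v Y) (Z p) + g p (Y p) (nab p v Z)"

text \<open>The tangent space of \<open>N\<^sub>1 \<times> N\<^sub>2\<close> at \<open>(p, q)\<close> is the product of the tangent spaces.\<close>

definition warped_metric ::
    "('a \<Rightarrow> 'e \<Rightarrow> 'e \<Rightarrow> real) \<Rightarrow> ('a \<Rightarrow> real) \<Rightarrow> ('b \<Rightarrow> 'f \<Rightarrow> 'f \<Rightarrow> real) \<Rightarrow>
     'a \<times> 'b \<Rightarrow> 'e \<times> 'f \<Rightarrow> 'e \<times> 'f \<Rightarrow> real" where
  "warped_metric g1 f g2 x v w =
     g1 (fst x) (fst v) (fst w) + (f (fst x))\<^sup>2 * g2 (snd x) (snd v) (snd w)"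

definition local_orthonormal_frame ::
    "('a::topological_space, 'e::euclidean_space) manifold \<Rightarrow> ('a \<Rightarrow> 'e \<Rightarrow> 'e \<Rightarrow> real) \<Rightarrow>
     ('a \<Rightarrow> 'e set) \<Rightarrow> nat \<Rightarrow> 'a set \<Rightarrow> (nat \<Rightarrow> 'a \<Rightarrow> 'e) \<Rightarrow> bool" where
  "local_orthonormal_frame M g D k U e \<longleftrightarrow> open U \<and>
     (\<forall>i<k. smooth_vector_field_on M U (e i)) \<and>
     (\<forall>p\<in>U. (\<forall>i<k. \<forall>j<k. g p (e i p) (e j p) = (if i = j then 1 else 0)) \<and>
             span ((\<lambda>i. e i p) ` {..<k}) = D p)"


section \<open>Isometric immersions\<close>

definition isometric_immersion ::
    "('a::topological_space, 'e::euclidean_space) manifold \<Rightarrow> ('a \<Rightarrow> 'e \<Rightarrow> 'e \<Rightarrow> real) \<Rightarrow>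
     ('b::topological_space, 'f::euclidean_space) manifold \<Rightarrow> ('b \<Rightarrow> 'f \<Rightarrow> 'f \<Rightarrow> real) \<Rightarrow>
     ('a \<Rightarrow> 'b) \<Rightarrow> bool" where
  "isometric_immersion M g N g' F \<longleftrightarrow> smooth_map M N F \<and>
     (\<forall>p. inj (differential M N F p)) \<and>
     (\<forall>p v w. g' (F p) (differential M N F p v) (differential M N F p w) = g p v w)"

definition normal_space ::
    "('a, 'e::euclidean_space) manifold \<Rightarrow> ('b, 'f::euclidean_space) manifold \<Rightarrow>
     ('b \<Rightarrow> 'f \<Rightarrow> 'f \<Rightarrow> real) \<Rightarrow> ('a \<Rightarrow> 'b) \<Rightarrow> 'a \<Rightarrow> 'f set" where
  "normal_space M N g' F p = {u. \<forall>v. g' (F p) u (differential M N F p v) = 0}"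

definition normal_part ::
    "('a, 'e::euclidean_space) manifold \<Rightarrow> ('b, 'f::euclidean_space) manifold \<Rightarrow>
     ('b \<Rightarrow> 'f \<Rightarrow> 'f \<Rightarrow> real) \<Rightarrow> ('a \<Rightarrow> 'b) \<Rightarrow> 'a \<Rightarrow> 'f \<Rightarrow> 'f" where
  "normal_part M N g' F p u =
     (THE n. n \<in> normal_space M N g' F p \<and> u - n \<in> range (differential M N F p))"

text \<open>The covariant derivative at \<open>p\<close>, along the tangent vector \<open>v\<close> of \<open>M\<close>, of a vector field \<open>W\<close>
  along \<open>F\<close> (so that \<open>W q\<close> is tangent to \<open>N\<close> at \<open>F q\<close>).  Writing \<open>W = \<Sum>\<^sub>i W\<^sup>i \<partial>\<^sub>i\<close> in the chosen
  chart of \<open>N\<close> at \<open>F p\<close>, it is \<open>\<Sum>\<^sub>i v(W\<^sup>i) \<partial>\<^sub>i + W\<^sup>i(p) nab (F p) (dF v) \<partial>\<^sub>i\<close>, and the second sum is the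
  covariant derivative of the field on \<open>N\<close> with constant components \<open>W\<^sup>i(p)\<close>.  When \<open>W\<close> extends
  to a local vector field on \<open>N\<close>, this is its covariant derivative along \<open>dF v\<close>.\<close>

definition covariant_deriv_along ::
    "('a, 'e::euclidean_space) manifold \<Rightarrow> ('b, 'f::euclidean_space) manifold \<Rightarrow>
     ('b \<Rightarrow> 'f \<Rightarrow> ('b \<Rightarrow> 'f) \<Rightarrow> 'f) \<Rightarrow> ('a \<Rightarrow> 'b) \<Rightarrow> 'a \<Rightarrow> 'e \<Rightarrow> ('a \<Rightarrow> 'f) \<Rightarrow> 'f" where
  "covariant_deriv_along M N nab F p v W =
     (let c = chart_at N (F p)
      in dir_deriv M (\<lambda>q. to_chart N c (F q) (W q)) p v +
         nab (F p) (differential M N F p v) (\<lambda>y. from_chart N c y (W p)))"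

definition second_fundamental_form ::
    "('a, 'e::euclidean_space) manifold \<Rightarrow> ('b, 'f::euclidean_space) manifold \<Rightarrow>
     ('b \<Rightarrow> 'f \<Rightarrow> 'f \<Rightarrow> real) \<Rightarrow> ('b \<Rightarrow> 'f \<Rightarrow> ('b \<Rightarrow> 'f) \<Rightarrow> 'f) \<Rightarrow> ('a \<Rightarrow> 'b) \<Rightarrow>
     ('a \<Rightarrow> 'e) \<Rightarrow> ('a \<Rightarrow> 'e) \<Rightarrow> 'a \<Rightarrow> 'f" where
  "second_fundamental_form M N g' nab F X Y p =
     normal_part M N g' F p
       (covariant_deriv_along M N nab F p (X p) (\<lambda>q. differential M N F q (Y q)))"

text \<open>\<open>D\<close> is a distribution of rank \<open>k\<close> on \<open>(M, g)\<close>, which is immersed into \<open>(N, g')\<close> by \<open>F\<close>;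
  \<open>nab\<close> is the Levi-Civita connection of \<open>(N, g')\<close>.\<close>

definition distribution_minimal ::
    "('a::topological_space, 'e::euclidean_space) manifold \<Rightarrow> ('a \<Rightarrow> 'e \<Rightarrow> 'e \<Rightarrow> real) \<Rightarrow>
     ('b, 'f::euclidean_space) manifold \<Rightarrow> ('b \<Rightarrow> 'f \<Rightarrow> 'f \<Rightarrow> real) \<Rightarrow>
     ('b \<Rightarrow> 'f \<Rightarrow> ('b \<Rightarrow> 'f) \<Rightarrow> 'f) \<Rightarrow> ('a \<Rightarrow> 'b) \<Rightarrow> ('a \<Rightarrow> 'e set) \<Rightarrow> nat \<Rightarrow> bool" where
  "distribution_minimal M g N g' nab F D k \<longleftrightarrow>
     (\<forall>U e. local_orthonormal_frame M g D k U e \<longrightarrow>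
        (\<forall>p\<in>U. (\<Sum>i<k. second_fundamental_form M N g' nab F (e i) (e i) p) = 0))"


section \<open>Cosymplectic manifolds and contact CR-warped products\<close>

locale almost_contact_metric_manifold = riemannian_manifold M g
  for M :: "('a::{t2_space,second_countable_topology}, 'e::euclidean_space) manifold"
    and g :: "'a \<Rightarrow> 'e \<Rightarrow> 'e \<Rightarrow> real" +
  fixes \<phi> :: "'a \<Rightarrow> 'e \<Rightarrow> 'e" and \<xi> :: "'a \<Rightarrow> 'e" and \<eta> :: "'a \<Rightarrow> 'e \<Rightarrow> real"
  assumes odd_dim: "odd DIM('e)"
    and phi_linear: "linear (\<phi> p)"
    and phi_smooth: "open U \<Longrightarrow> smooth_vector_field_on M U X \<Longrightarrow>
      smooth_vector_field_on M U (\<lambda>p. \<phi> p (X p))"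
    and xi_smooth: "smooth_vector_field_on M UNIV \<xi>"
    and xi_unit: "g p (\<xi> p) (\<xi> p) = 1"
    and eta_eq: "\<eta> p v = g p v (\<xi> p)"
    and phi_phi: "\<phi> p (\<phi> p v) = - v + \<eta> p v *\<^sub>R \<xi> p"
    and phi_xi: "\<phi> p (\<xi> p) = 0"
    and eta_phi: "\<eta> p (\<phi> p v) = 0"
    and metric_phi: "g p (\<phi> p v) (\<phi> p w) = g p v w - \<eta> p v * \<eta> p w"

text \<open>The last condition says that \<open>(nab\<^sub>v \<phi>) Y = nab\<^sub>v (\<phi> Y) - \<phi> (nab\<^sub>v Y)\<close> vanishes.\<close>

locale cosymplectic_manifold =
  almost_contact_metric_manifold M g \<phi> \<xi> \<eta> + levi_civita_connection M g nab
  for M :: "('a::{t2_space,second_countable_topology}, 'e::euclidean_space) manifold"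
    and g :: "'a \<Rightarrow> 'e \<Rightarrow> 'e \<Rightarrow> real"
    and \<phi> :: "'a \<Rightarrow> 'e \<Rightarrow> 'e" and \<xi> :: "'a \<Rightarrow> 'e" and \<eta> :: "'a \<Rightarrow> 'e \<Rightarrow> real"
    and nab :: "'a \<Rightarrow> 'e \<Rightarrow> ('a \<Rightarrow> 'e) \<Rightarrow> 'e" +
  assumes phi_parallel: "open U \<Longrightarrow> p \<in> U \<Longrightarrow> smooth_vector_field_on M U Y \<Longrightarrow>
    nab p v (\<lambda>q. \<phi> q (Y q)) - \<phi> p (nab p v Y) = 0"

text \<open>The distributions on \<open>N\<^sub>1 \<times> N\<^sub>2\<close> tangent to the two factors.\<close>

definition fst_distribution :: "'p \<Rightarrow> ('e::real_vector \<times> 'f::real_vector) set" where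
  "fst_distribution x = UNIV \<times> {0}"

definition snd_distribution :: "'p \<Rightarrow> ('e::real_vector \<times> 'f::real_vector) set" where
  "snd_distribution x = {0} \<times> UNIV"

locale contact_CR_warped_product_submanifold =
  NT: riemannian_manifold NT gT + NP: riemannian_manifold NP gP +
  ambient: almost_contact_metric_manifold M g \<phi> \<xi> \<eta>
  for NT :: "('a::{t2_space,second_countable_topology}, 'e::euclidean_space) manifold"
    and gT :: "'a \<Rightarrow> 'e \<Rightarrow> 'e \<Rightarrow> real"
    and NP :: "('b::{t2_space,second_countable_topology}, 'f::euclidean_space) manifold"
    and gP :: "'b \<Rightarrow> 'f \<Rightarrow> 'f \<Rightarrow> real"
    and M :: "('c::{t2_space,second_countable_topology}, 'd::euclidean_space) manifold"
    and g :: "'c \<Rightarrow> 'd \<Rightarrow> 'd \<Rightarrow> real"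
    and \<phi> :: "'c \<Rightarrow> 'd \<Rightarrow> 'd" and \<xi> :: "'c \<Rightarrow> 'd" and \<eta> :: "'c \<Rightarrow> 'd \<Rightarrow> real" +
  fixes f :: "'a \<Rightarrow> real" and \<iota> :: "'a \<times> 'b \<Rightarrow> 'c"
  assumes warping_smooth: "smooth_fun_on NT UNIV f"
    and warping_pos: "f p > 0"
    and immersed: "isometric_immersion (prod_manifold NT NP) (warped_metric gT f gP) M g \<iota>"
    and xi_tangent: "\<xi> (\<iota> x) \<in> differential (prod_manifold NT NP) M \<iota> x ` fst_distribution x"
    and invariant: "\<phi> (\<iota> x) ` differential (prod_manifold NT NP) M \<iota> x ` fst_distribution x
      \<subseteq> differential (prod_manifold NT NP) M \<iota> x ` fst_distribution x"
    and anti_invariant: "\<phi> (\<iota> x) ` differential (prod_manifold NT NP) M \<iota> x ` snd_distribution x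
      \<subseteq> normal_space (prod_manifold NT NP) M g \<iota> x"

end

theory Submission
  imports Defs
begin

text \<open>Restrict the ambient covariant derivative of \<open>d\<iota> Y\<close> along \<open>d\<iota> X\<close> to \<open>X, Y\<close> in \<open>D\<^sub>T\<close> and
  reduce it modulo \<open>R = d\<iota> D\<^sub>T\<close>.  This gives a symmetric bilinear form \<open>B\<close> on \<open>D\<^sub>T\<close>, and since \<open>\<phi>\<close>
  is parallel and preserves \<open>R\<close>, \<open>B(X, \<phi> Y) = \<phi> B(X, Y)\<close>.  As \<open>\<phi>\<close> is skew, the trace of \<open>B(X, \<phi> Y)\<close>
  vanishes, so \<open>\<phi>\<close> annihilates the trace of \<open>B\<close> modulo \<open>R\<close>; and \<open>\<phi>\<^sup>2 = -1\<close> modulo \<open>R\<close> because \<open>\<xi>\<close>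
  lies in \<open>R\<close>.  Hence the trace of \<open>B\<close> is tangent to \<open>M\<close>, and its normal part is zero.\<close>

section \<open>Calculus\<close>

text \<open>The reduction is modulo R and not modulo the whole tangent space of the submanifold,
  because \<phi> sends the directions of the second factor to normal vectors and need not preserve
  that tangent space. Since R consists of tangent vectors, knowing the trace modulo R is enough in
  the end. The obstacle is the rule B(X, \<phi> Y) = \<phi> B(X, Y). It comes from differentiating
  \<phi> (d\<iota> Y) = d\<iota> (J Y), where J is the endomorphism induced on the first factor, but
  invariance is given point by point as an inclusion of sets and says nothing about
  differentiability of J. \<open>derivative_in_range_modulo\<close> differentiates the mere
  membership in the image of the first factor. This works because in product charts that image is
  the range of an explicit smooth family of linear maps. In coordinates B is the second derivative
  of \<iota> plus a Christoffel term, so it depends on values at one point only; its symmetry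
  combines equality of mixed derivatives with vanishing torsion.\<close>

lemma has_frechet_derivative:
  "f differentiable at x \<Longrightarrow> (f has_derivative frechet_derivative f (at x)) (at x)"
  by (simp add: frechet_derivative_works [symmetric])

lemma frechet_derivative_eqI:
  "(f has_derivative f') (at x) \<Longrightarrow> frechet_derivative f (at x) = f'"
  using frechet_derivative_at by metis

section \<open>Closure properties of finite differentiability\<close>

lemma times_differentiable_on_SucD:
  "times_differentiable_on (Suc k) S f \<Longrightarrow> times_differentiable_on k S f"
proof (induction k arbitrary: f)
  case 0
  then show ?case
    by (auto intro!: continuous_at_imp_continuous_on differentiable_imp_continuous_within)
next
  case (Suc k)
  then show ?case
    by (metis times_differentiable_on.simps(2))
qed

lemma times_differentiable_on_mono:
  "times_differentiable_on k T f \<Longrightarrow> S \<subseteq> T \<Longrightarrow> times_differentiable_on k S f"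
  by (induction k arbitrary: f) (auto intro: continuous_on_subset)

lemma times_differentiable_on_cong:
  assumes "times_differentiable_on k S f" "open S" "\<And>x. x \<in> S \<Longrightarrow> f x = g x"
  shows "times_differentiable_on k S g"
  using assms(1,3)
proof (induction k arbitrary: f g)
  case 0
  then show ?case
    by (simp cong: continuous_on_cong)
next
  case (Suc k)
  have der: "(g has_derivative frechet_derivative f (at x)) (at x)" if "x \<in> S" for x
    using that Suc.prems
    by (intro has_derivative_transform_within_open [OF has_frechet_derivative assms(2)]) auto
  have "times_differentiable_on k S (\<lambda>x. frechet_derivative g (at x) v)" for v
  proof (rule Suc.IH)
    show "times_differentiable_on k S (\<lambda>x. frechet_derivative f (at x) v)"
      using Suc.prems(1) by simp
  qed (simp add: frechet_derivative_eqI [OF der])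
  then show ?case
    using der by (auto intro: differentiableI)
qed

lemma times_differentiable_on_const: "times_differentiable_on k S (\<lambda>x. c)"
  by (induction k arbitrary: c) auto

text \<open>Lets an explicit formula stand for \<open>frechet_derivative\<close> on
  \<open>S\<close>, so that the inductive steps below need only a differentiation rule and the
  induction hypothesis.\<close>

lemma times_differentiable_on_SucI:
  assumes "open S" "\<And>x. x \<in> S \<Longrightarrow> (f has_derivative f' x) (at x)"
    and "\<And>v. times_differentiable_on k S (\<lambda>x. f' x v)"
  shows "times_differentiable_on (Suc k) S f"
  using assms(2) times_differentiable_on_cong [OF assms(3) assms(1)]
  by (auto intro: differentiableI simp: frechet_derivative_eqI [OF assms(2)])

lemma times_differentiable_on_add:
  assumes "open S" "times_differentiable_on k S f" "times_differentiable_on k S g"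
  shows "times_differentiable_on k S (\<lambda>x. f x + g x)"
  using assms(2,3)
proof (induction k arbitrary: f g)
  case 0
  then show ?case by (auto intro: continuous_intros)
next
  case (Suc k)
  show ?case
    using Suc.prems
    by (intro times_differentiable_on_SucI [OF assms(1), where
      f' = "\<lambda>x v. frechet_derivative f (at x) v + frechet_derivative g (at x) v"])
      (auto intro!: has_derivative_add has_frechet_derivative Suc.IH)
qed

lemma times_differentiable_on_sum:
  assumes "open S" "\<And>i. i \<in> I \<Longrightarrow> times_differentiable_on k S (f i)"
  shows "times_differentiable_on k S (\<lambda>x. \<Sum>i\<in>I. f i x)"
  using assms(2)
  by (induction I rule: infinite_finite_induct)
    (auto intro: times_differentiable_on_const times_differentiable_on_add assms(1))

lemma times_differentiable_on_bounded_linear: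
  assumes "open S" "bounded_linear L" "times_differentiable_on k S f"
  shows "times_differentiable_on k S (\<lambda>x. L (f x))"
  using assms(3)
proof (induction k arbitrary: f)
  case 0
  then show ?case using assms(2)
    by (auto intro: bounded_linear.continuous_on)
next
  case (Suc k)
  show ?case
    using Suc.prems
    by (intro times_differentiable_on_SucI [OF assms(1), where
      f' = "\<lambda>x v. L (frechet_derivative f (at x) v)"])
      (auto intro!: bounded_linear.has_derivative [OF assms(2)] has_frechet_derivative Suc.IH)
qed

lemma times_differentiable_on_scaleR:
  fixes f :: "'a::real_normed_vector \<Rightarrow> real"
  assumes "open S" "times_differentiable_on k S f" "times_differentiable_on k S g"
  shows "times_differentiable_on k S (\<lambda>x. f x *\<^sub>R g x)"
  using assms(2,3)
proof (induction k arbitrary: f g)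
  case 0
  then show ?case by (auto intro: continuous_intros)
next
  case (Suc k)
  show ?case
    using Suc.prems Suc.prems [THEN times_differentiable_on_SucD]
    by (intro times_differentiable_on_SucI [OF assms(1), where
      f' = "\<lambda>x v. f x *\<^sub>R frechet_derivative g (at x) v + frechet_derivative f (at x) v *\<^sub>R g x"])
      (auto intro!: has_derivative_scaleR has_frechet_derivative Suc.IH
        times_differentiable_on_add assms(1))
qed

lemma linear_euclidean_sum:
  fixes L :: "'a::euclidean_space \<Rightarrow> 'b::real_vector"
  assumes "linear L"
  shows "L v = (\<Sum>b\<in>Basis. (v \<bullet> b) *\<^sub>R L b)"
proof -
  have "L v = L (\<Sum>b\<in>Basis. (v \<bullet> b) *\<^sub>R b)"
    by (simp add: euclidean_representation)
  then show ?thesis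
    by (simp add: linear_sum [OF assms] linear_cmul [OF assms])
qed

lemma times_differentiable_on_compose:
  fixes g :: "'a::real_normed_vector \<Rightarrow> 'b::euclidean_space"
  assumes "open S" "open T" "g ` S \<subseteq> T"
    and "times_differentiable_on k T f" "times_differentiable_on k S g"
  shows "times_differentiable_on k S (\<lambda>x. f (g x))"
  using assms(4,5)
proof (induction k arbitrary: f)
  case 0
  then show ?case
    using continuous_on_compose2 [OF _ _ assms(3), of f] by simp
next
  case (Suc k)
  have df: "f differentiable at (g x)" and dg: "g differentiable at x" if "x \<in> S" for x
    using Suc.prems assms(3) that by auto
  \<comment> \<open>The chain rule applies the derivative of \<open>f\<close> to a vector that moves
    with \<open>x\<close>, whereas the induction hypothesis covers fixed directions. Expanding over
    \<open>Basis\<close> separates the two.\<close>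
  define f' where "f' x v = (\<Sum>b\<in>Basis. (frechet_derivative g (at x) v \<bullet> b) *\<^sub>R
      frechet_derivative f (at (g x)) b)" for x v
  have eq: "f' x = (\<lambda>v. frechet_derivative f (at (g x)) (frechet_derivative g (at x) v))"
    if "x \<in> S" for x
    unfolding f'_def
    by (rule ext, rule linear_euclidean_sum [symmetric])
      (rule linear_frechet_derivative [OF df [OF that]])
  show ?case
  proof (rule times_differentiable_on_SucI [OF assms(1), where f' = f'])
    show "((\<lambda>x. f (g x)) has_derivative f' x) (at x)" if "x \<in> S" for x
      unfolding eq [OF that]
      by (intro has_derivative_compose [OF has_frechet_derivative [OF dg [OF that]]
            has_frechet_derivative [OF df [OF that]]])
    have "times_differentiable_on k S (\<lambda>x. frechet_derivative f (at (g x)) b)" for b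
      using Suc.prems(1) times_differentiable_on_SucD [OF Suc.prems(2)]
      by (intro Suc.IH [of "\<lambda>y. frechet_derivative f (at y) b"]) auto
    moreover have "times_differentiable_on k S (\<lambda>x. frechet_derivative g (at x) v \<bullet> b)" for v b
      using Suc.prems(2)
      by (intro times_differentiable_on_bounded_linear [OF assms(1) bounded_linear_inner_left]) auto
    ultimately show "times_differentiable_on k S (\<lambda>x. f' x v)" for v
      unfolding f'_def
      by (intro times_differentiable_on_sum times_differentiable_on_scaleR assms(1))
  qed
qed

section \<open>Smooth functions\<close>

lemma smooth_on_mono: "smooth_on T f \<Longrightarrow> S \<subseteq> T \<Longrightarrow> smooth_on S f"
  by (auto simp: smooth_on_def intro: times_differentiable_on_mono)

lemma smooth_on_cong:
  "smooth_on S f \<Longrightarrow> open S \<Longrightarrow> (\<And>x. x \<in> S \<Longrightarrow> f x = g x) \<Longrightarrow> smooth_on S g"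
  by (auto simp: smooth_on_def intro: times_differentiable_on_cong)

lemma smooth_on_const: "smooth_on S (\<lambda>x. c)"
  by (simp add: smooth_on_def times_differentiable_on_const)

lemma smooth_on_add:
  "open S \<Longrightarrow> smooth_on S f \<Longrightarrow> smooth_on S g \<Longrightarrow> smooth_on S (\<lambda>x. f x + g x)"
  by (simp add: smooth_on_def times_differentiable_on_add)

lemma smooth_on_scaleR:
  "open S \<Longrightarrow> smooth_on S f \<Longrightarrow> smooth_on S g \<Longrightarrow> smooth_on S (\<lambda>x. f x *\<^sub>R g x)"
  by (simp add: smooth_on_def times_differentiable_on_scaleR)

lemma smooth_on_bounded_linear:
  "open S \<Longrightarrow> bounded_linear L \<Longrightarrow> smooth_on S f \<Longrightarrow> smooth_on S (\<lambda>x. L (f x))"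
  by (simp add: smooth_on_def times_differentiable_on_bounded_linear)

lemma smooth_on_compose:
  fixes g :: "'a::real_normed_vector \<Rightarrow> 'b::euclidean_space"
  assumes "open S" "open T" "g ` S \<subseteq> T" "smooth_on T f" "smooth_on S g"
  shows "smooth_on S (\<lambda>x. f (g x))"
  using assms by (auto simp: smooth_on_def intro: times_differentiable_on_compose)

lemma smooth_on_ident: "open S \<Longrightarrow> smooth_on S (\<lambda>x. x)"
  unfolding smooth_on_def
proof
  show "open S \<Longrightarrow> times_differentiable_on k S (\<lambda>x. x)" for k
    by (cases k) (auto simp: times_differentiable_on_const)
qed

lemma smooth_on_Pair:
  assumes "open S" "smooth_on S f" "smooth_on S g"
  shows "smooth_on S (\<lambda>x. (f x, g x))"
proof -
  have "bounded_linear (\<lambda>u. (u, 0))" "bounded_linear (\<lambda>u. (0, u))"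
    by (auto intro: bounded_linear_intros)
  then have "smooth_on S (\<lambda>x. (f x, 0) + (0, g x))"
    by (intro smooth_on_add smooth_on_bounded_linear [of _ "\<lambda>u. (u, 0)"]
        smooth_on_bounded_linear [of _ "\<lambda>u. (0, u)"] assms)
  then show ?thesis by simp
qed

lemma smooth_on_differentiable: "smooth_on S f \<Longrightarrow> x \<in> S \<Longrightarrow> f differentiable at x"
  unfolding smooth_on_def by (metis times_differentiable_on.simps(2))

lemma smooth_on_frechet_derivative:
  "smooth_on S f \<Longrightarrow> smooth_on S (\<lambda>x. frechet_derivative f (at x) v)"
  unfolding smooth_on_def by (metis times_differentiable_on.simps(2))

text \<open>The second difference quotient of \<open>f\<close> along \<open>v\<close> and \<open>w\<close>, symmetric in both,
  converges to the second derivative.\<close>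

lemma second_difference_tendsto:
  fixes f :: "'a::real_normed_vector \<Rightarrow> real"
  assumes "open S" "x \<in> S" and diff: "\<And>y. y \<in> S \<Longrightarrow> f differentiable at y"
    and der: "((\<lambda>y. frechet_derivative f (at y) v) has_derivative D) (at x)"
  shows "((\<lambda>t. (f (x + t *\<^sub>R v + t *\<^sub>R w) - f (x + t *\<^sub>R v) - f (x + t *\<^sub>R w) + f x) / t\<^sup>2)
    \<longlongrightarrow> D w) (at_right 0)"
proof (rule tendstoI)
  fix e :: real assume "e > 0"
  \<comment> \<open>\<open>K\<close> exceeds \<open>norm v + norm w\<close>, so the two errors
    below, each at most \<open>e / (2 * K) * (t * (norm v + norm w))\<close>, add up to less than
    \<open>t * e\<close>; the summand 1 keeps \<open>K\<close> positive when both vectors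
    vanish.\<close>
  define K where "K = 2 * (norm v + norm w) + 1"
  have K: "K > 0" by (simp add: K_def add_nonneg_pos)
  define F where "F y = frechet_derivative f (at y) v" for y
  have linD: "linear D" using der has_derivative_linear by blast
  obtain d1 where d1: "d1 > 0" "ball x d1 \<subseteq> S"
    using assms(1,2) openE by blast
  have ek: "e / (2 * K) > 0" using K \<open>e > 0\<close> by simp
  obtain d2 where d2: "d2 > 0"
    and F: "\<And>y. norm (y - x) < d2 \<Longrightarrow> norm (F y - F x - D (y - x)) \<le> e / (2 * K) * norm (y - x)"
    using der ek unfolding has_derivative_at_alt F_def by meson
  define d where "d = min d1 d2 / K"
  have d: "d > 0" using d1 d2 K by (simp add: d_def)
  have main: "dist ((f (x + t *\<^sub>R v + t *\<^sub>R w) - f (x + t *\<^sub>R v) - f (x + t *\<^sub>R w) + f x) / t\<^sup>2) (D w) < e"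
    if t: "0 < t" "t < d" for t
  proof -
    have tK: "t * K < min d1 d2"
      using t K by (simp add: d_def field_simps)
    have near: "norm (s *\<^sub>R v + r *\<^sub>R w) \<le> t * (norm v + norm w)" 
      if "0 \<le> s" "s \<le> t" "0 \<le> r" "r \<le> t" for s r
    proof -
      have "norm (s *\<^sub>R v + r *\<^sub>R w) \<le> s * norm v + r * norm w"
        using norm_triangle_ineq [of "s *\<^sub>R v" "r *\<^sub>R w"] that by simp
      also have "\<dots> \<le> t * norm v + t * norm w"
        using that by (intro add_mono mult_right_mono) auto
      finally show ?thesis by (simp add: algebra_simps)
    qed
    have le: "t * (norm v + norm w) < min d1 d2"
    proof -
      have "t * (norm v + norm w) \<le> t * K"
        using t by (intro mult_left_mono) (auto simp: K_def)
      then show ?thesis using tK by linarith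
    qed
    have inS: "x + s *\<^sub>R v + r *\<^sub>R w \<in> S" if "0 \<le> s" "s \<le> t" "0 \<le> r" "r \<le> t" for s r
    proof -
      have "dist x (x + s *\<^sub>R v + r *\<^sub>R w) = norm (s *\<^sub>R v + r *\<^sub>R w)"
        by (metis add.assoc dist_add_cancel dist_0_norm add_0_right)
      then show ?thesis
        using near [OF that] le d1(2) by (auto simp: subset_eq)
    qed
    \<comment> \<open>The numerator is \<open>\<psi> t - \<psi> 0\<close>, an increment along
      \<open>v\<close> of an increment along \<open>w\<close>. The mean value theorem turns it into
      a difference of two values of \<open>F\<close>, both controlled by differentiability of
      \<open>F\<close> at \<open>x\<close>.\<close>
    define \<psi> where "\<psi> s = f (x + s *\<^sub>R v + t *\<^sub>R w) - f (x + s *\<^sub>R v)" for s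
    have line: "((\<lambda>s. f (x + s *\<^sub>R v + r *\<^sub>R w)) has_real_derivative F (x + s *\<^sub>R v + r *\<^sub>R w)) (at s)"
      if "0 \<le> s" "s \<le> t" "0 \<le> r" "r \<le> t" for s r
    proof -
      have dd: "f differentiable at (x + s *\<^sub>R v + r *\<^sub>R w)" using diff inS that by blast
      have 1: "((\<lambda>s. x + s *\<^sub>R v + r *\<^sub>R w) has_derivative (\<lambda>h. h *\<^sub>R v)) (at s)"
        by (auto intro!: derivative_eq_intros)
      have "((\<lambda>s. f (x + s *\<^sub>R v + r *\<^sub>R w)) has_derivative
          (\<lambda>h. frechet_derivative f (at (x + s *\<^sub>R v + r *\<^sub>R w)) (h *\<^sub>R v))) (at s)"
        by (rule has_derivative_compose [OF 1 has_frechet_derivative [OF dd]])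
      then show ?thesis
        unfolding has_field_derivative_def F_def
        using linear_cmul [OF linear_frechet_derivative [OF dd]]
        by (simp add: mult_commute_abs)
    qed
    have "\<exists>z. 0 < z \<and> z < t \<and> \<psi> t - \<psi> 0 = (t - 0) * (F (x + z *\<^sub>R v + t *\<^sub>R w) - F (x + z *\<^sub>R v))"
    proof (rule MVT2)
      show "0 < t" using t by simp
      show "(\<psi> has_real_derivative F (x + s *\<^sub>R v + t *\<^sub>R w) - F (x + s *\<^sub>R v)) (at s)"
        if "0 \<le> s" "s \<le> t" for s
        unfolding \<psi>_def using line [of s t] line [of s 0] that t
        by (intro DERIV_diff) auto
    qed
    then obtain z where z: "0 < z" "z < t"
      and mv: "\<psi> t - \<psi> 0 = t * (F (x + z *\<^sub>R v + t *\<^sub>R w) - F (x + z *\<^sub>R v))"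
      by auto
    have B: "norm (F (x + z *\<^sub>R v + r *\<^sub>R w) - F x - D (z *\<^sub>R v + r *\<^sub>R w)) \<le> e / (2 * K) * (t * (norm v + norm w))"
      if "0 \<le> r" "r \<le> t" for r
    proof -
      have n: "norm (z *\<^sub>R v + r *\<^sub>R w) \<le> t * (norm v + norm w)"
        using near z that by simp
      have "norm (F (x + z *\<^sub>R v + r *\<^sub>R w) - F x - D (z *\<^sub>R v + r *\<^sub>R w)) \<le> e / (2 * K) * norm (z *\<^sub>R v + r *\<^sub>R w)"
        using F [of "x + z *\<^sub>R v + r *\<^sub>R w"] n le by (simp add: add.assoc)
      also have "\<dots> \<le> e / (2 * K) * (t * (norm v + norm w))"
        using n ek by (intro mult_left_mono) auto
      finally show ?thesis .
    qed
    have DD: "D (z *\<^sub>R v + t *\<^sub>R w) - D (z *\<^sub>R v) = t * D w"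
      by (simp add: linear_add [OF linD] linear_cmul [OF linD])
    have "\<bar>(F (x + z *\<^sub>R v + t *\<^sub>R w) - F (x + z *\<^sub>R v)) - t * D w\<bar> \<le> 2 * (e / (2 * K) * (t * (norm v + norm w)))"
    proof -
      let ?E = "e / (2 * K) * (t * (norm v + norm w))"
      have "\<bar>F (x + z *\<^sub>R v + t *\<^sub>R w) - F x - D (z *\<^sub>R v + t *\<^sub>R w)\<bar> \<le> ?E"
        and "\<bar>F (x + z *\<^sub>R v) - F x - D (z *\<^sub>R v)\<bar> \<le> ?E"
        using B [of t] B [of 0] t by simp_all
      then show ?thesis using DD by linarith
    qed
    also have "\<dots> = t * e * ((norm v + norm w) / K)" by simp
    also have "\<dots> < t * e * 1"
      using t \<open>e > 0\<close> K by (intro mult_strict_left_mono) (auto simp: K_def field_simps add_nonneg_pos)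
    finally have bound: "\<bar>(F (x + z *\<^sub>R v + t *\<^sub>R w) - F (x + z *\<^sub>R v)) - t * D w\<bar> < t * e" by simp
    have num: "f (x + t *\<^sub>R v + t *\<^sub>R w) - f (x + t *\<^sub>R v) - f (x + t *\<^sub>R w) + f x
        = t * (F (x + z *\<^sub>R v + t *\<^sub>R w) - F (x + z *\<^sub>R v))"
      using mv by (simp add: \<psi>_def)
    have eq: "t * P / t\<^sup>2 - D w = (P - t * D w) / t" for P
      using t by (simp add: power2_eq_square diff_divide_distrib)
    then show ?thesis
      unfolding num dist_real_def eq using bound t by (simp add: abs_divide pos_divide_less_eq mult.commute)
  qed
  then show "\<forall>\<^sub>F t in at_right 0. dist ((f (x + t *\<^sub>R v + t *\<^sub>R w) - f (x + t *\<^sub>R v) - f (x + t *\<^sub>R w) + f x) / t\<^sup>2) (D w) < e"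
    unfolding eventually_at_right_field using d by blast
qed

text \<open>Exchanging \<open>v\<close> and \<open>w\<close> leaves the second difference quotient
  unchanged, so both values are its limit. The quotient is handled by the mean value theorem for
  real functions, hence the passage to components \<open>f y \<bullet> b\<close>.\<close>

lemma second_derivative_symmetric:
  fixes f :: "'a::real_normed_vector \<Rightarrow> 'b::euclidean_space"
  assumes S: "open S" "x \<in> S" and diff: "\<And>y. y \<in> S \<Longrightarrow> f differentiable at y"
    and dv: "((\<lambda>y. frechet_derivative f (at y) v) has_derivative Dv) (at x)"
    and dw: "((\<lambda>y. frechet_derivative f (at y) w) has_derivative Dw) (at x)"
  shows "Dv w = Dw v"
proof (rule euclidean_eqI)
  fix b :: 'b
  define fb where "fb y = f y \<bullet> b" for y
  have fb: "(fb has_derivative (\<lambda>h. frechet_derivative f (at y) h \<bullet> b)) (at y)" if "y \<in> S" for y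
    unfolding fb_def by (intro has_derivative_inner_left has_frechet_derivative diff that)
  have "((\<lambda>y. frechet_derivative fb (at y) u) has_derivative (\<lambda>h. D h \<bullet> b)) (at x)"
    if "((\<lambda>y. frechet_derivative f (at y) u) has_derivative D) (at x)" for u D
    by (rule has_derivative_transform_within_open [OF has_derivative_inner_left [OF that] S])
      (simp add: frechet_derivative_eqI [OF fb])
  note d = this [OF dv] this [OF dw]
  have diffb: "\<And>y. y \<in> S \<Longrightarrow> fb differentiable at y" using fb differentiableI by blast
  have lim1: "((\<lambda>t. (fb (x + t *\<^sub>R v + t *\<^sub>R w) - fb (x + t *\<^sub>R v) - fb (x + t *\<^sub>R w) + fb x) / t\<^sup>2)
      \<longlongrightarrow> Dv w \<bullet> b) (at_right 0)"
    by (rule second_difference_tendsto [OF S diffb d(1)])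
  have "((\<lambda>t. (fb (x + t *\<^sub>R w + t *\<^sub>R v) - fb (x + t *\<^sub>R w) - fb (x + t *\<^sub>R v) + fb x) / t\<^sup>2)
      \<longlongrightarrow> Dw v \<bullet> b) (at_right 0)"
    by (rule second_difference_tendsto [OF S diffb d(2)])
  moreover have "fb (x + t *\<^sub>R w + t *\<^sub>R v) - fb (x + t *\<^sub>R w) - fb (x + t *\<^sub>R v) + fb x
      = fb (x + t *\<^sub>R v + t *\<^sub>R w) - fb (x + t *\<^sub>R v) - fb (x + t *\<^sub>R w) + fb x" for t
    by (simp add: add.assoc add.commute [of "t *\<^sub>R w" "t *\<^sub>R v"])
  ultimately have "((\<lambda>t. (fb (x + t *\<^sub>R v + t *\<^sub>R w) - fb (x + t *\<^sub>R v) - fb (x + t *\<^sub>R w) + fb x) / t\<^sup>2)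
      \<longlongrightarrow> Dw v \<bullet> b) (at_right 0)"
    by (simp only:)
  then show "Dv w \<bullet> b = Dw v \<bullet> b"
    by (rule tendsto_unique [OF trivial_limit_at_right_real lim1])
qed

text \<open>Expanding over \<open>Basis\<close> makes \<open>A y (E y)\<close> a finite sum of
  scalars times \<open>A y b\<close>, so the product rule applies although the derivative of the
  family \<open>A\<close> is given only on fixed vectors.\<close>

lemma has_derivative_apply_linear:
  fixes E :: "'a::real_normed_vector \<Rightarrow> 'b::euclidean_space"
  assumes A: "\<And>w. ((\<lambda>y. A y w) has_derivative (\<lambda>v. A' w v)) (at x)"
    and E: "(E has_derivative E') (at x)"
    and lin: "\<And>y. y \<in> S \<Longrightarrow> linear (A y)" and S: "open S" "x \<in> S"
  shows "((\<lambda>y. A y (E y)) has_derivative (\<lambda>v. A x (E' v) + A' (E x) v)) (at x)"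
proof -
  have "((\<lambda>y. \<Sum>b\<in>Basis. (E y \<bullet> b) *\<^sub>R A y b) has_derivative
      (\<lambda>v. \<Sum>b\<in>Basis. (E x \<bullet> b) *\<^sub>R A' b v + (E' v \<bullet> b) *\<^sub>R A x b)) (at x)"
    by (intro has_derivative_sum has_derivative_scaleR A has_derivative_inner_left E)
  moreover have "((\<lambda>y. \<Sum>b\<in>Basis. (E x \<bullet> b) *\<^sub>R A y b) has_derivative
      (\<lambda>v. \<Sum>b\<in>Basis. (E x \<bullet> b) *\<^sub>R A' b v)) (at x)"
    by (intro has_derivative_sum has_derivative_scaleR_right A)
  then have "((\<lambda>y. A y (E x)) has_derivative (\<lambda>v. \<Sum>b\<in>Basis. (E x \<bullet> b) *\<^sub>R A' b v)) (at x)"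
    by (rule has_derivative_transform_within_open [OF _ S])
      (metis linear_euclidean_sum lin)
  \<comment> \<open>Linearity of \<open>A'\<close> in its first argument comes from uniqueness of
    the derivative.\<close>
  then have "A' (E x) = (\<lambda>v. \<Sum>b\<in>Basis. (E x \<bullet> b) *\<^sub>R A' b v)"
    using A has_derivative_unique by blast
  then have "(\<lambda>v. \<Sum>b\<in>Basis. (E x \<bullet> b) *\<^sub>R A' b v + (E' v \<bullet> b) *\<^sub>R A x b)
      = (\<lambda>v. A x (E' v) + A' (E x) v)"
    by (auto simp: sum.distrib linear_euclidean_sum [OF lin [OF S(2)], symmetric])
  ultimately show ?thesis
    by (auto intro: has_derivative_transform_within_open [OF _ S]
        simp: linear_euclidean_sum [OF lin, symmetric])
qed

text \<open>If \<open>h y = A y (j y)\<close>, then \<open>j\<close> need not be differentiable, but it is Lipschitz at \<open>x\<close>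
  because \<open>A x\<close> is injective, and this suffices for \<open>(A y - A x) (j y)\<close> to be of second order.\<close>

lemma derivative_in_range_modulo:
  fixes A :: "'a::real_normed_vector \<Rightarrow> 'b::euclidean_space \<Rightarrow> 'd::euclidean_space"
  assumes S: "open S" "x \<in> S" and lin: "\<And>y. y \<in> S \<Longrightarrow> linear (A y)"
    and A: "\<And>w. ((\<lambda>y. A y w) has_derivative (\<lambda>v. A' w v)) (at x)"
    and inj: "inj (A x)"
    and h: "(h has_derivative h') (at x)"
    and range: "\<And>y. y \<in> S \<Longrightarrow> h y \<in> range (A y)" and z: "h x = A x z"
  shows "h' v - A' z v \<in> range (A x)"
proof -
  \<comment> \<open>Subtracting \<open>A y z\<close> keeps the value in the range of
    \<open>A y\<close> and makes it vanish at \<open>x\<close>, so the difference quotients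
    \<open>q n\<close> below are plain multiples of values of \<open>k\<close>.\<close>
  define k where "k y = h y - A y z" for y
  have k: "(k has_derivative (\<lambda>v. h' v - A' z v)) (at x)"
    unfolding k_def by (intro has_derivative_diff h A)
  have "\<exists>u. k y = A y u" if y: "y \<in> S" for y
  proof -
    obtain u where "h y = A y u" using range [OF y] by auto
    then have "k y = A y (u - z)" by (simp add: k_def linear_diff [OF lin [OF y]])
    then show ?thesis ..
  qed
  then obtain j where j: "\<And>y. y \<in> S \<Longrightarrow> k y = A y (j y)" by metis
  have kx: "k x = 0" by (simp add: k_def z)
  obtain B where B: "B > 0" "\<And>u. B * norm u \<le> norm (A x u)"
    using linear_inj_bounded_below_pos [OF lin [OF S(2)] inj] by blast
  define y where "y n = x + inverse (real (Suc n)) *\<^sub>R v" for n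
  have y0: "(\<lambda>n. inverse (real (Suc n))) \<longlonglongrightarrow> 0"
    by (rule LIMSEQ_inverse_real_of_nat)
  have ylim: "y \<longlonglongrightarrow> x"
    unfolding y_def using tendsto_add [OF tendsto_const tendsto_scaleR [OF y0 tendsto_const]]
    by force
  then have yS: "\<forall>\<^sub>F n in sequentially. y n \<in> S"
    using S topological_tendstoD by blast
  define \<epsilon> where "\<epsilon> n = (\<Sum>b\<in>Basis. norm (A (y n) b - A x b))" for n
  have eps: "\<epsilon> \<longlonglongrightarrow> 0"
  proof -
    have "(\<lambda>n. A (y n) b) \<longlonglongrightarrow> A x b" for b
      using isCont_tendsto_compose [OF has_derivative_continuous [OF A] ylim] .
    then have "\<epsilon> \<longlonglongrightarrow> (\<Sum>b\<in>Basis. norm (A x b - A x b))"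
      unfolding \<epsilon>_def by (intro tendsto_intros)
    then show ?thesis by simp
  qed
  have close: "norm (A (y n) u - A x u) \<le> \<epsilon> n * norm u" if "y n \<in> S" for n u
  proof -
    have "A (y n) u - A x u = (\<Sum>b\<in>Basis. (u \<bullet> b) *\<^sub>R (A (y n) b - A x b))"
      using linear_euclidean_sum [OF lin [OF that], of u] linear_euclidean_sum [OF lin [OF S(2)], of u]
      by (simp add: sum_subtractf scaleR_diff_right)
    also have "norm \<dots> \<le> (\<Sum>b\<in>Basis. norm u * norm (A (y n) b - A x b))"
      by (rule sum_norm_le) (simp add: mult_right_mono Basis_le_norm)
    finally show ?thesis by (simp add: \<epsilon>_def sum_distrib_left mult.commute)
  qed
  define q where "q n = real (Suc n) *\<^sub>R k (y n)" for n
  have qlim: "q \<longlonglongrightarrow> h' v - A' z v"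
  proof -
    have 1: "((\<lambda>t. x + t *\<^sub>R v) has_derivative (\<lambda>t. t *\<^sub>R v)) (at 0)"
      by (auto intro!: derivative_eq_intros)
    have "((\<lambda>t. k (x + t *\<^sub>R v)) has_derivative (\<lambda>t. h' (t *\<^sub>R v) - A' z (t *\<^sub>R v))) (at 0)"
      by (rule has_derivative_compose [OF 1]) (simp add: k)
    moreover have "linear (\<lambda>v. h' v - A' z v)" using k has_derivative_linear by blast
    then have "(\<lambda>t. h' (t *\<^sub>R v) - A' z (t *\<^sub>R v)) = (\<lambda>t. t *\<^sub>R (h' v - A' z v))"
      using linear_cmul by blast
    ultimately have "((\<lambda>t. norm (k (x + t *\<^sub>R v) - t *\<^sub>R (h' v - A' z v)) / norm t) \<longlongrightarrow> 0) (at 0)"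
      by (simp add: has_derivative_at kx)
    moreover have "filterlim (\<lambda>n. inverse (real (Suc n))) (at 0) sequentially"
      using y0 by (simp add: filterlim_at)
    ultimately have "(\<lambda>n. norm (k (y n) - inverse (real (Suc n)) *\<^sub>R (h' v - A' z v)) /
        norm (inverse (real (Suc n)))) \<longlonglongrightarrow> 0"
      unfolding y_def by (rule filterlim_compose)
    moreover have "norm (k (y n) - inverse (real (Suc n)) *\<^sub>R (h' v - A' z v)) /
        norm (inverse (real (Suc n))) = norm (q n - (h' v - A' z v))" for n
    proof -
      have "q n - (h' v - A' z v) = real (Suc n) *\<^sub>R (k (y n) - inverse (real (Suc n)) *\<^sub>R (h' v - A' z v))"
        by (simp add: q_def scaleR_diff_right del: of_nat_Suc)
      then show ?thesis
        by (simp add: divide_inverse mult.commute del: of_nat_Suc)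
    qed
    ultimately have "(\<lambda>n. norm (q n - (h' v - A' z v))) \<longlonglongrightarrow> 0"
      by (simp only:)
    then show ?thesis
      using LIM_zero_cancel tendsto_norm_zero_iff by blast
  qed
  \<comment> \<open>Each \<open>q n\<close> lies in the range of \<open>A (y n)\<close>; applying
    \<open>A x\<close> to the same preimage changes it only by a null sequence.\<close>
  have diff0: "(\<lambda>n. q n - A x (real (Suc n) *\<^sub>R j (y n))) \<longlonglongrightarrow> 0"
  proof (rule Lim_null_comparison)
    \<comment> \<open>With \<open>B / 2\<close>, half of the lower bound \<open>B * norm u\<close>
      absorbs the error, which leaves \<open>norm u \<le> 2 / B * norm (q n)\<close>.\<close>
    have small: "\<forall>\<^sub>F n in sequentially. \<epsilon> n < B / 2"
      using eps B(1) order_tendstoD(2) by (metis half_gt_zero)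
    show "\<forall>\<^sub>F n in sequentially. norm (q n - A x (real (Suc n) *\<^sub>R j (y n)))
        \<le> \<epsilon> n * (2 / B * norm (q n))"
      using yS small
    proof eventually_elim
      case (elim n)
      define u where "u = real (Suc n) *\<^sub>R j (y n)"
      have qn: "q n = A (y n) u"
        using j [OF elim(1)] by (simp add: q_def u_def linear_cmul [OF lin [OF elim(1)]])
      have "B * norm u \<le> norm (A x u)" by (rule B)
      also have "\<dots> \<le> norm (A (y n) u) + norm (A (y n) u - A x u)"
        by (metis norm_triangle_sub add.commute norm_minus_commute)
      also have "\<dots> \<le> norm (q n) + B / 2 * norm u"
        using close [OF elim(1), of u] elim(2) mult_right_mono [of "\<epsilon> n" "B / 2" "norm u"] 
        by (simp add: qn)
      finally have "norm u \<le> 2 / B * norm (q n)"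
        using B(1) by (simp add: field_simps)
      moreover have "\<epsilon> n \<ge> 0" by (simp add: \<epsilon>_def sum_nonneg)
      ultimately have "\<epsilon> n * norm u \<le> \<epsilon> n * (2 / B * norm (q n))"
        by (rule mult_left_mono)
      then show ?case
        using close [OF elim(1), of u] by (simp only: qn flip: u_def)
    qed
    have "(\<lambda>n. \<epsilon> n * (2 / B * norm (q n))) \<longlonglongrightarrow> 0 * (2 / B * norm (h' v - A' z v))"
      by (intro tendsto_intros eps qlim)
    then show "(\<lambda>n. \<epsilon> n * (2 / B * norm (q n))) \<longlonglongrightarrow> 0" by simp
  qed
  have "(\<lambda>n. A x (real (Suc n) *\<^sub>R j (y n))) \<longlonglongrightarrow> h' v - A' z v"
    using tendsto_diff [OF qlim diff0] by simp
  moreover have "closed (range (A x))"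
    by (intro closed_subspace subspace_UNIV linear_subspace_image lin S)
  ultimately show ?thesis
    by (metis (no_types, lifting) closed_sequentially rangeI)
qed

section \<open>Charts and tangent vectors\<close>

lemma is_chartD:
  assumes "is_chart c"
  shows "open (chart_dom c)"
    and "p \<in> chart_dom c \<Longrightarrow> chart_inv c (chart_map c p) = p"
    and "y \<in> chart_map c ` chart_dom c \<Longrightarrow> chart_map c (chart_inv c y) = y"
    and "y \<in> chart_map c ` chart_dom c \<Longrightarrow> chart_inv c y \<in> chart_dom c"
    and "continuous_on (chart_dom c) (chart_map c)"
    and "continuous_on (chart_map c ` chart_dom c) (chart_inv c)"
    and "inj_on (chart_map c) (chart_dom c)"
  using assms unfolding is_chart_def homeomorphism_def
  by (auto intro: inj_on_inverseI [of _ "chart_inv c"])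

lemma is_chart_open_image:
  assumes "is_chart c" "open V"
  shows "open (chart_map c ` (chart_dom c \<inter> V))"
proof -
  have eq: "chart_map c ` (chart_dom c \<inter> V) = chart_map c ` chart_dom c \<inter> chart_inv c -` V"
    using is_chartD [OF assms(1)] by force
  have "open (chart_map c ` chart_dom c)"
    using assms(1) by (simp add: is_chart_def)
  with is_chartD(6) [OF assms(1)] show ?thesis
    unfolding eq using assms(2) by (metis Int_commute continuous_on_open_vimage)
qed

text \<open>\<open>chart_inv\<close> comes from \<open>inv_into\<close>, whose value outside the
  image is arbitrary; hence the comparison over the image only.\<close>

lemma chart_inv_prod_chart:
  assumes "is_chart c" "is_chart d" "y \<in> chart_map c ` chart_dom c \<times> chart_map d ` chart_dom d"
  shows "chart_inv (prod_chart c d) y = (chart_inv c (fst y), chart_inv d (snd y))"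
proof -
  have inj: "inj_on (map_prod (chart_map c) (chart_map d)) (chart_dom c \<times> chart_dom d)"
    using is_chartD(7) [OF assms(1)] is_chartD(7) [OF assms(2)] by (rule map_prod_inj_on)
  obtain p q where y: "y = (chart_map c p, chart_map d q)" "p \<in> chart_dom c" "q \<in> chart_dom d"
    using assms(3) by auto
  have "chart_inv (prod_chart c d) y = (p, q)"
    using inv_into_f_f [OF inj, of "(p, q)"] y by (simp add: chart_inv_def prod_chart_def)
  then show ?thesis
    using y by (simp add: is_chartD(2) assms)
qed

lemma prod_chart_simps [simp]:
  "chart_dom (prod_chart c d) = chart_dom c \<times> chart_dom d"
  "chart_map (prod_chart c d) = map_prod (chart_map c) (chart_map d)"
  by (simp_all add: prod_chart_def)

lemma is_chart_prod_chart:
  assumes "is_chart c" "is_chart d"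
  shows "is_chart (prod_chart c d)"
proof -
  let ?C = "chart_map c ` chart_dom c" and ?D = "chart_map d ` chart_dom d"
  note C = is_chartD [OF assms(1)] and D = is_chartD [OF assms(2)]
  have im: "map_prod (chart_map c) (chart_map d) ` (chart_dom c \<times> chart_dom d) = ?C \<times> ?D"
    by auto
  have "open ?C" "open ?D" using assms by (simp_all add: is_chart_def)
  moreover have "homeomorphism (chart_dom c \<times> chart_dom d) (?C \<times> ?D)
      (map_prod (chart_map c) (chart_map d)) (\<lambda>y. (chart_inv c (fst y), chart_inv d (snd y)))"
  proof (rule homeomorphismI)
    show "continuous_on (chart_dom c \<times> chart_dom d) (map_prod (chart_map c) (chart_map d))"
      unfolding map_prod_def case_prod_unfold
      by (intro continuous_on_Pair continuous_on_compose2 [OF C(5)]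
          continuous_on_compose2 [OF D(5)] continuous_on_fst continuous_on_snd continuous_on_id) auto
    show "continuous_on (?C \<times> ?D) (\<lambda>y. (chart_inv c (fst y), chart_inv d (snd y)))"
      by (intro continuous_on_Pair continuous_on_compose2 [OF C(6)]
          continuous_on_compose2 [OF D(6)] continuous_on_fst continuous_on_snd continuous_on_id) auto
  qed (auto simp: C D)
  then have "homeomorphism (chart_dom c \<times> chart_dom d) (?C \<times> ?D)
      (map_prod (chart_map c) (chart_map d)) (chart_inv (prod_chart c d))"
    by (rule homeomorphism_cong) (auto simp: chart_inv_prod_chart assms)
  ultimately show ?thesis
    using C(1) D(1) by (simp add: is_chart_def im open_Times)
qed

section \<open>Changes of chart and smoothness on a manifold\<close>

context smooth_manifold
begin

lemma chart_at [simp]: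
  "chart_at M p \<in> atlas M" "p \<in> chart_dom (chart_at M p)" "is_chart (chart_at M p)"
  using chart_at_atlas chart_at_dom charts by blast+

lemma chart_inv_chart_map:
  "c \<in> atlas M \<Longrightarrow> p \<in> chart_dom c \<Longrightarrow> chart_inv c (chart_map c p) = p"
  using charts is_chartD(2) by blast

lemma open_chart_image:
  "c \<in> atlas M \<Longrightarrow> open V \<Longrightarrow> open (chart_map c ` (chart_dom c \<inter> V))"
  using charts is_chart_open_image by blast

lemma open_chart_dom: "c \<in> atlas M \<Longrightarrow> open (chart_dom c)"
  using charts is_chartD(1) by blast

text \<open>On the overlap, \<open>f \<circ> chart_inv c\<close> is
  \<open>f \<circ> chart_inv d\<close> after the transition map, so this is the chain rule.\<close>

lemma change_of_chart:
  fixes f :: "'a \<Rightarrow> 'v::real_normed_vector"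
  assumes c: "c \<in> atlas M" "p \<in> chart_dom c" and d: "d \<in> atlas M" "p \<in> chart_dom d"
    and f: "((f \<circ> chart_inv d) has_derivative f') (at (chart_map d p))"
  shows "((f \<circ> chart_inv c) has_derivative
      (\<lambda>v. f' (frechet_derivative (chart_map d \<circ> chart_inv c) (at (chart_map c p)) v)))
      (at (chart_map c p))"
proof -
  let ?S = "chart_map c ` (chart_dom c \<inter> chart_dom d)" and ?T = "chart_map d \<circ> chart_inv c"
  have S: "open ?S" "chart_map c p \<in> ?S"
    using c d by (auto intro: open_chart_image open_chart_dom)
  have "?T differentiable at (chart_map c p)"
    using smooth_on_differentiable [OF transition_smooth [OF c(1) d(1)] S(2)] .
  moreover have "(f \<circ> chart_inv d has_derivative f') (at (?T (chart_map c p)))"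
    using f c by (simp add: chart_inv_chart_map)
  ultimately have "((\<lambda>y. (f \<circ> chart_inv d) (?T y)) has_derivative
      (\<lambda>v. f' (frechet_derivative ?T (at (chart_map c p)) v))) (at (chart_map c p))"
    by (intro has_derivative_compose [OF has_frechet_derivative])
  then show ?thesis
    by (rule has_derivative_transform_within_open [OF _ S])
      (auto simp: chart_inv_chart_map c d)
qed

lemma transition_has_derivative:
  assumes "c \<in> atlas M" "p \<in> chart_dom c" "d \<in> atlas M" "p \<in> chart_dom d"
  shows "((chart_map d \<circ> chart_inv c) has_derivative
      frechet_derivative (chart_map d \<circ> chart_inv c) (at (chart_map c p))) (at (chart_map c p))"
  using smooth_on_differentiable [OF transition_smooth [OF assms(1,3)]] assms
  by (intro has_frechet_derivative) auto

lemma transition_derivative_self: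
  assumes "c \<in> atlas M" "p \<in> chart_dom c"
  shows "frechet_derivative (chart_map c \<circ> chart_inv c) (at (chart_map c p)) = (\<lambda>v. v)"
proof (rule frechet_derivative_eqI)
  show "(chart_map c \<circ> chart_inv c has_derivative (\<lambda>v. v)) (at (chart_map c p))"
    by (rule has_derivative_transform_within_open [OF has_derivative_ident
          open_chart_image [OF assms(1) open_UNIV]])
      (use assms in \<open>auto simp: chart_inv_chart_map\<close>)
qed

text \<open>The cocycle rule for Jacobians, obtained from \<open>change_of_chart\<close> for the
  coordinate map of \<open>e\<close>. It makes \<open>to_chart\<close> and \<open>from_chart\<close>
  mutually inverse.\<close>

lemma transition_derivative_compose:
  assumes "c \<in> atlas M" "p \<in> chart_dom c" "d \<in> atlas M" "p \<in> chart_dom d"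
    "e \<in> atlas M" "p \<in> chart_dom e"
  shows "frechet_derivative (chart_map e \<circ> chart_inv d) (at (chart_map d p))
      (frechet_derivative (chart_map d \<circ> chart_inv c) (at (chart_map c p)) v)
    = frechet_derivative (chart_map e \<circ> chart_inv c) (at (chart_map c p)) v"
  using frechet_derivative_eqI [OF change_of_chart
      [OF assms(1-4) transition_has_derivative [OF assms(3-6)]]] by simp

lemma linear_to_chart: "c \<in> atlas M \<Longrightarrow> p \<in> chart_dom c \<Longrightarrow> linear (to_chart M c p)"
  unfolding to_chart_def using transition_has_derivative [of "chart_at M p" p c]
  by (auto dest: has_derivative_linear)

lemma linear_from_chart: "c \<in> atlas M \<Longrightarrow> p \<in> chart_dom c \<Longrightarrow> linear (from_chart M c p)"
  unfolding from_chart_def using transition_has_derivative [of c p "chart_at M p"]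
  by (auto dest: has_derivative_linear)

lemma to_chart_from_chart:
  assumes "c \<in> atlas M" "p \<in> chart_dom c" "d \<in> atlas M" "p \<in> chart_dom d"
  shows "to_chart M d p (from_chart M c p w) =
    frechet_derivative (chart_map d \<circ> chart_inv c) (at (chart_map c p)) w"
  unfolding to_chart_def from_chart_def
  by (rule transition_derivative_compose) (use assms in simp_all)

lemma to_chart_from_chart_self [simp]:
  "c \<in> atlas M \<Longrightarrow> p \<in> chart_dom c \<Longrightarrow> to_chart M c p (from_chart M c p w) = w"
  by (simp add: to_chart_from_chart transition_derivative_self)

lemma from_chart_to_chart [simp]:
  assumes "c \<in> atlas M" "p \<in> chart_dom c"
  shows "from_chart M c p (to_chart M c p v) = v"
  unfolding to_chart_def from_chart_def
  using transition_derivative_compose [of "chart_at M p" p c "chart_at M p"] assms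
  by (simp add: transition_derivative_self)

lemma to_chart_chart_at [simp]: "to_chart M (chart_at M p) p v = v"
  by (simp add: to_chart_def transition_derivative_self)

lemma from_chart_chart_at [simp]: "from_chart M (chart_at M p) p v = v"
  by (simp add: from_chart_def transition_derivative_self)

lemma smooth_on_change_of_chart:
  assumes c: "c \<in> atlas M" "U \<subseteq> chart_dom c" and d: "d \<in> atlas M" and U: "open U"
    and h: "smooth_on (chart_map c ` U) h"
  shows "smooth_on (chart_map d ` (chart_dom d \<inter> U)) (\<lambda>y. h ((chart_map c \<circ> chart_inv d) y))"
proof (rule smooth_on_compose)
  show "smooth_on (chart_map d ` (chart_dom d \<inter> U)) (chart_map c \<circ> chart_inv d)"
    by (rule smooth_on_mono [OF transition_smooth [OF d c(1)]]) (use c(2) in auto)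
  show "open (chart_map c ` U)"
    using open_chart_image [OF c(1) U] c(2) by (simp add: Int_absorb1)
qed (use c d U h in \<open>auto simp: chart_inv_chart_map intro: open_chart_image\<close>)

text \<open>Transition maps are smooth, so a single chart whose domain contains \<open>U\<close>
  decides smoothness in the whole atlas.\<close>

lemma smooth_fun_onI:
  assumes c: "c \<in> atlas M" "U \<subseteq> chart_dom c" and U: "open U"
    and f: "smooth_on (chart_map c ` U) (f \<circ> chart_inv c)"
  shows "smooth_fun_on M U f"
  unfolding smooth_fun_on_def
proof
  fix d assume d: "d \<in> atlas M"
  show "smooth_on (chart_map d ` (chart_dom d \<inter> U)) (f \<circ> chart_inv d)"
    by (rule smooth_on_cong [OF smooth_on_change_of_chart [OF c d U f]])
      (use c d U in \<open>auto simp: chart_inv_chart_map subset_eq intro: open_chart_image\<close>)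
qed

lemma smooth_vector_field_on_add:
  assumes U: "open U" and "smooth_vector_field_on M U X" "smooth_vector_field_on M U Y"
  shows "smooth_vector_field_on M U (\<lambda>p. X p + Y p)"
  unfolding smooth_vector_field_on_def
proof
  fix c assume c: "c \<in> atlas M"
  let ?S = "chart_map c ` (chart_dom c \<inter> U)"
  have S: "open ?S" using c U by (rule open_chart_image)
  have "smooth_on ?S (\<lambda>y. ((\<lambda>q. to_chart M c q (X q)) \<circ> chart_inv c) y
      + ((\<lambda>q. to_chart M c q (Y q)) \<circ> chart_inv c) y)"
    using assms(2,3) c by (intro smooth_on_add S) (auto simp: smooth_vector_field_on_def comp_def)
  then show "smooth_on ?S ((\<lambda>q. to_chart M c q (X q + Y q)) \<circ> chart_inv c)"
    by (rule smooth_on_cong [OF _ S])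
      (use c in \<open>auto simp: chart_inv_chart_map linear_add [OF linear_to_chart]\<close>)
qed

lemma smooth_vector_field_on_scaleR:
  assumes U: "open U" and "smooth_fun_on M U f" "smooth_vector_field_on M U Y"
  shows "smooth_vector_field_on M U (\<lambda>p. f p *\<^sub>R Y p)"
  unfolding smooth_vector_field_on_def
proof
  fix c assume c: "c \<in> atlas M"
  let ?S = "chart_map c ` (chart_dom c \<inter> U)"
  have S: "open ?S" using c U by (rule open_chart_image)
  have "smooth_on ?S (\<lambda>y. (f \<circ> chart_inv c) y *\<^sub>R ((\<lambda>q. to_chart M c q (Y q)) \<circ> chart_inv c) y)"
    using assms(2,3) c
    by (intro smooth_on_scaleR S) (auto simp: smooth_vector_field_on_def smooth_fun_on_def comp_def)
  then show "smooth_on ?S ((\<lambda>q. to_chart M c q (f q *\<^sub>R Y q)) \<circ> chart_inv c)"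
    by (rule smooth_on_cong [OF _ S])
      (use c in \<open>auto simp: chart_inv_chart_map linear_cmul [OF linear_to_chart]\<close>)
qed

lemma smooth_fun_on_const: "smooth_fun_on M U (\<lambda>p. a)"
  by (simp add: smooth_fun_on_def smooth_on_const comp_def)

lemma smooth_vector_field_on_cong:
  assumes U: "open U" and "smooth_vector_field_on M U X" and "\<And>q. q \<in> U \<Longrightarrow> X q = Y q"
  shows "smooth_vector_field_on M U Y"
  unfolding smooth_vector_field_on_def
proof
  fix c assume c: "c \<in> atlas M"
  show "smooth_on (chart_map c ` (chart_dom c \<inter> U)) ((\<lambda>q. to_chart M c q (Y q)) \<circ> chart_inv c)"
    by (rule smooth_on_cong [of _ "(\<lambda>q. to_chart M c q (X q)) \<circ> chart_inv c"])
      (use assms c in \<open>auto simp: smooth_vector_field_on_def chart_inv_chart_map intro: open_chart_image\<close>)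
qed

text \<open>In another chart the components are the derivative of the transition map in the fixed
  direction \<open>w\<close>.\<close>

lemma smooth_vector_field_on_from_chart:
  assumes c: "c \<in> atlas M"
  shows "smooth_vector_field_on M (chart_dom c) (\<lambda>p. from_chart M c p w)"
  unfolding smooth_vector_field_on_def
proof
  fix d assume d: "d \<in> atlas M"
  let ?S = "chart_map d ` (chart_dom d \<inter> chart_dom c)" and ?U = "chart_dom c \<inter> chart_dom d"
  have U: "open ?U" using c d by (auto intro: open_chart_dom)
  have "smooth_on ?S (\<lambda>y. frechet_derivative (chart_map d \<circ> chart_inv c)
      (at ((chart_map c \<circ> chart_inv d) y)) w)"
    by (rule smooth_on_mono [OF smooth_on_change_of_chart [OF c _ d U
        smooth_on_frechet_derivative [OF transition_smooth [OF c d]]]]) auto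
  then show "smooth_on ?S ((\<lambda>q. to_chart M d q (from_chart M c q w)) \<circ> chart_inv d)"
    by (rule smooth_on_cong)
      (use c d in \<open>auto simp: chart_inv_chart_map to_chart_from_chart intro: open_chart_image open_chart_dom\<close>)
qed

lemma smooth_fun_on_to_chart:
  assumes "c \<in> atlas M" "U \<subseteq> chart_dom c" "open U" "smooth_vector_field_on M U X"
  shows "smooth_fun_on M U (\<lambda>p. to_chart M c p (X p) \<bullet> b)"
proof (rule smooth_fun_onI [OF assms(1-3)])
  have "smooth_on (chart_map c ` U) ((\<lambda>q. to_chart M c q (X q)) \<circ> chart_inv c)"
    using assms by (auto simp: smooth_vector_field_on_def Int_absorb1)
  then have "smooth_on (chart_map c ` U)
      (\<lambda>y. ((\<lambda>q. to_chart M c q (X q)) \<circ> chart_inv c) y \<bullet> b)"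
    using open_chart_image [OF assms(1,3)] assms(2)
    by (intro smooth_on_bounded_linear [OF _ bounded_linear_inner_left]) (simp_all add: Int_absorb1 comp_def)
  then show "smooth_on (chart_map c ` U) ((\<lambda>p. to_chart M c p (X p) \<bullet> b) \<circ> chart_inv c)"
    by (simp add: comp_def)
qed

end

section \<open>Differentials of smooth maps\<close>

lemma smooth_map_has_derivative:
  assumes "smooth_map M N F" "c \<in> atlas M" "d \<in> atlas N" "p \<in> chart_dom c" "F p \<in> chart_dom d"
  shows "((chart_map d \<circ> F \<circ> chart_inv c) has_derivative
    frechet_derivative (chart_map d \<circ> F \<circ> chart_inv c) (at (chart_map c p))) (at (chart_map c p))"
  using assms unfolding smooth_map_def
  by (intro has_frechet_derivative smooth_on_differentiable
      [where S = "chart_map c ` (chart_dom c \<inter> F -` chart_dom d)"]) auto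

text \<open>\<open>differential\<close> is read in the chosen charts at \<open>p\<close> and
  \<open>F p\<close>, which vary with the point; to differentiate it, the charts must be held fixed.
  The proof computes the derivative of \<open>chart_map d \<circ> F \<circ> chart_inv C\<close>
  twice, through the chosen chart at \<open>F p\<close> and through \<open>c\<close>.\<close>

lemma to_chart_differential:
  assumes M: "smooth_manifold M" and N: "smooth_manifold N" and F: "smooth_map M N F"
    and c: "c \<in> atlas M" "p \<in> chart_dom c" and d: "d \<in> atlas N" "F p \<in> chart_dom d"
  shows "to_chart N d (F p) (differential M N F p v) =
    frechet_derivative (chart_map d \<circ> F \<circ> chart_inv c) (at (chart_map c p)) (to_chart M c p v)"
proof -
  interpret M: smooth_manifold M by fact
  interpret N: smooth_manifold N by fact
  define C where "C = chart_at M p"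
  define l where "l = chart_at N (F p)"
  have C: "C \<in> atlas M" "p \<in> chart_dom C" and l: "l \<in> atlas N" "F p \<in> chart_dom l"
    by (simp_all add: C_def l_def)
  let ?G = "chart_map l \<circ> F \<circ> chart_inv C" and ?x = "chart_map C p"
  let ?S = "chart_map C ` (chart_dom C \<inter> F -` (chart_dom l \<inter> chart_dom d))"
  have "continuous_on UNIV F" using F by (simp add: smooth_map_def)
  then have "open (F -` (chart_dom l \<inter> chart_dom d))"
    using d(1) l(1) by (intro open_vimage open_Int N.open_chart_dom)
  then have S: "open ?S" "?x \<in> ?S"
    using M.open_chart_image [OF C(1)] C d l by auto
  have "((\<lambda>y. (chart_map d \<circ> chart_inv l) (?G y)) has_derivative (\<lambda>v.
      frechet_derivative (chart_map d \<circ> chart_inv l) (at (chart_map l (F p)))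
        (frechet_derivative ?G (at ?x) v))) (at ?x)"
  proof (rule has_derivative_compose [OF smooth_map_has_derivative [OF F C(1) l(1) C(2) l(2)]])
    have "?G ?x = chart_map l (F p)" by (simp add: M.chart_inv_chart_map C)
    then show "((\<lambda>y. (chart_map d \<circ> chart_inv l) y) has_derivative
        frechet_derivative (chart_map d \<circ> chart_inv l) (at (chart_map l (F p)))) (at (?G ?x))"
      using N.transition_has_derivative [OF l d] by (simp only:)
  qed
  then have 1: "((chart_map d \<circ> F \<circ> chart_inv C) has_derivative (\<lambda>v.
      frechet_derivative (chart_map d \<circ> chart_inv l) (at (chart_map l (F p)))
        (frechet_derivative ?G (at ?x) v))) (at ?x)"
    by (rule has_derivative_transform_within_open [OF _ S])
      (auto simp: M.chart_inv_chart_map N.chart_inv_chart_map C l)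
  have 2: "((chart_map d \<circ> F \<circ> chart_inv C) has_derivative (\<lambda>v.
      frechet_derivative (chart_map d \<circ> F \<circ> chart_inv c) (at (chart_map c p))
      (frechet_derivative (chart_map c \<circ> chart_inv C) (at ?x) v))) (at ?x)"
    by (rule M.change_of_chart [OF C c smooth_map_has_derivative [OF F c(1) d(1) c(2) d(2)]])
  show ?thesis
    using fun_cong [OF has_derivative_unique [OF 1 2], of v]
    unfolding to_chart_def differential_def C_def l_def .
qed

section \<open>Product manifolds\<close>

lemma prod_manifold_simps [simp]:
  "chart_at (prod_manifold M N) (p, q) = prod_chart (chart_at M p) (chart_at N q)"
  by (simp add: prod_manifold_def)

lemma in_atlas_prod_manifold:
  "c \<in> atlas M \<Longrightarrow> d \<in> atlas N \<Longrightarrow> prod_chart c d \<in> atlas (prod_manifold M N)"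
  by (auto simp: prod_manifold_def)

lemma smooth_manifold_prod_manifold:
  fixes M :: "('a::{t2_space,second_countable_topology}, 'e::euclidean_space) manifold"
    and N :: "('b::{t2_space,second_countable_topology}, 'f::euclidean_space) manifold"
  assumes "smooth_manifold M" "smooth_manifold N"
  shows "smooth_manifold (prod_manifold M N)"
proof -
  interpret M: smooth_manifold M by fact
  interpret N: smooth_manifold N by fact
  show ?thesis
  proof
    show "is_chart c" if "c \<in> atlas (prod_manifold M N)" for c
      using that by (auto simp: prod_manifold_def intro: is_chart_prod_chart M.charts N.charts)
    show "chart_at (prod_manifold M N) p \<in> atlas (prod_manifold M N)" for p
      by (cases p) (simp add: in_atlas_prod_manifold)
    show "p \<in> chart_dom (chart_at (prod_manifold M N) p)" for p
      by (cases p) simp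
    show "smooth_on (chart_map c ` (chart_dom c \<inter> chart_dom d)) (chart_map d \<circ> chart_inv c)"
      if cd: "c \<in> atlas (prod_manifold M N)" "d \<in> atlas (prod_manifold M N)" for c d
    proof -
      obtain c1 c2 d1 d2 where c: "c = prod_chart c1 c2" "c1 \<in> atlas M" "c2 \<in> atlas N"
        and d: "d = prod_chart d1 d2" "d1 \<in> atlas M" "d2 \<in> atlas N"
        using cd by (auto simp: prod_manifold_def)
      let ?S1 = "chart_map c1 ` (chart_dom c1 \<inter> chart_dom d1)"
      let ?S2 = "chart_map c2 ` (chart_dom c2 \<inter> chart_dom d2)"
      have S: "open ?S1" "open ?S2"
        using c d by (auto intro: M.open_chart_image N.open_chart_image M.open_chart_dom N.open_chart_dom)
      have im: "chart_map c ` (chart_dom c \<inter> chart_dom d) = ?S1 \<times> ?S2"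
        by (auto simp: c d)
      have op: "open (?S1 \<times> ?S2)" using S by (rule open_Times)
      have "smooth_on (?S1 \<times> ?S2) (\<lambda>y. (chart_map d1 \<circ> chart_inv c1) (fst y))"
        by (rule smooth_on_compose [OF op S(1) _ M.transition_smooth [OF c(2) d(2)]])
          (auto intro: smooth_on_bounded_linear [OF op bounded_linear_fst smooth_on_ident [OF op]])
      moreover have "smooth_on (?S1 \<times> ?S2) (\<lambda>y. (chart_map d2 \<circ> chart_inv c2) (snd y))"
        by (rule smooth_on_compose [OF op S(2) _ N.transition_smooth [OF c(3) d(3)]])
          (auto intro: smooth_on_bounded_linear [OF op bounded_linear_snd smooth_on_ident [OF op]])
      ultimately have "smooth_on (?S1 \<times> ?S2) (\<lambda>y. ((chart_map d1 \<circ> chart_inv c1) (fst y),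
          (chart_map d2 \<circ> chart_inv c2) (snd y)))"
        by (rule smooth_on_Pair [OF op])
      then show ?thesis
        unfolding im
        by (rule smooth_on_cong [OF _ op])
          (auto simp: c d chart_inv_prod_chart M.charts N.charts)
    qed
  qed
qed

text \<open>Transition maps between product charts act on each factor separately, so tangency to a
  factor can be read off in any product chart.\<close>

lemma transition_derivative_prod_chart:
  assumes M: "smooth_manifold M" and N: "smooth_manifold N"
    and c: "c \<in> atlas M" "p \<in> chart_dom c" and c': "c' \<in> atlas M" "p \<in> chart_dom c'"
    and d: "d \<in> atlas N" "q \<in> chart_dom d" and d': "d' \<in> atlas N" "q \<in> chart_dom d'"
  shows "frechet_derivative (chart_map (prod_chart c' d') \<circ> chart_inv (prod_chart c d))
      (at (chart_map (prod_chart c d) (p, q))) v =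
    (frechet_derivative (chart_map c' \<circ> chart_inv c) (at (chart_map c p)) (fst v),
     frechet_derivative (chart_map d' \<circ> chart_inv d) (at (chart_map d q)) (snd v))"
proof -
  interpret M: smooth_manifold M by fact
  interpret N: smooth_manifold N by fact
  let ?x = "(chart_map c p, chart_map d q)"
  let ?S = "chart_map c ` chart_dom c \<times> chart_map d ` chart_dom d"
  have S: "open ?S" "?x \<in> ?S"
    using M.open_chart_image [OF c(1) open_UNIV] N.open_chart_image [OF d(1) open_UNIV] c d
    by (auto intro: open_Times)
  have "((\<lambda>y. (chart_map c' \<circ> chart_inv c) (fst y)) has_derivative
      (\<lambda>v. frechet_derivative (chart_map c' \<circ> chart_inv c) (at (chart_map c p)) (fst v))) (at ?x)"
    using M.transition_has_derivative [OF c c']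
    by (intro has_derivative_compose [OF bounded_linear_imp_has_derivative [OF bounded_linear_fst]]) (simp only: fst_conv)
  moreover have "((\<lambda>y. (chart_map d' \<circ> chart_inv d) (snd y)) has_derivative
      (\<lambda>v. frechet_derivative (chart_map d' \<circ> chart_inv d) (at (chart_map d q)) (snd v))) (at ?x)"
    using N.transition_has_derivative [OF d d']
    by (intro has_derivative_compose [OF bounded_linear_imp_has_derivative [OF bounded_linear_snd]]) (simp only: snd_conv)
  ultimately have "((\<lambda>y. ((chart_map c' \<circ> chart_inv c) (fst y), (chart_map d' \<circ> chart_inv d) (snd y)))
      has_derivative (\<lambda>v. (frechet_derivative (chart_map c' \<circ> chart_inv c) (at (chart_map c p)) (fst v),
        frechet_derivative (chart_map d' \<circ> chart_inv d) (at (chart_map d q)) (snd v)))) (at ?x)"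
    by (rule has_derivative_Pair)
  then have "(chart_map (prod_chart c' d') \<circ> chart_inv (prod_chart c d)
      has_derivative (\<lambda>v. (frechet_derivative (chart_map c' \<circ> chart_inv c) (at (chart_map c p)) (fst v),
        frechet_derivative (chart_map d' \<circ> chart_inv d) (at (chart_map d q)) (snd v)))) (at ?x)"
    by (rule has_derivative_transform_within_open [OF _ S])
      (auto simp: chart_inv_prod_chart M.charts N.charts c d)
  then show ?thesis
    by (simp add: frechet_derivative_eqI)
qed

lemma to_chart_prod_chart:
  assumes "smooth_manifold M" "smooth_manifold N"
    and "c \<in> atlas M" "p \<in> chart_dom c" "d \<in> atlas N" "q \<in> chart_dom d"
  shows "to_chart (prod_manifold M N) (prod_chart c d) (p, q) v =
    (to_chart M c p (fst v), to_chart N d q (snd v))"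
  unfolding to_chart_def prod_manifold_simps
  by (rule transition_derivative_prod_chart)
    (use assms in \<open>auto simp: smooth_manifold.chart_at\<close>)

lemma from_chart_prod_chart:
  assumes "smooth_manifold M" "smooth_manifold N"
    and "c \<in> atlas M" "p \<in> chart_dom c" "d \<in> atlas N" "q \<in> chart_dom d"
  shows "from_chart (prod_manifold M N) (prod_chart c d) (p, q) v =
    (from_chart M c p (fst v), from_chart N d q (snd v))"
  unfolding from_chart_def prod_manifold_simps
  by (rule transition_derivative_prod_chart)
    (use assms in \<open>auto simp: smooth_manifold.chart_at\<close>)

section \<open>Connections in coordinates\<close>

lemma dir_deriv_const [simp]: "dir_deriv M (\<lambda>q. a) p v = 0"
  by (simp add: dir_deriv_def comp_def)

context smooth_manifold
begin

lemma smooth_vector_field_on_mono: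
  "smooth_vector_field_on M U X \<Longrightarrow> V \<subseteq> U \<Longrightarrow> smooth_vector_field_on M V X"
  unfolding smooth_vector_field_on_def by (blast intro: smooth_on_mono)

lemma smooth_vector_field_on_zero: "open U \<Longrightarrow> smooth_vector_field_on M U (\<lambda>q. 0)"
  unfolding smooth_vector_field_on_def
  by (intro ballI, rule smooth_on_cong [OF smooth_on_const [of _ 0]])
    (auto simp: chart_inv_chart_map linear_0 [OF linear_to_chart] intro: open_chart_image)

lemma smooth_vector_field_on_sum:
  "open U \<Longrightarrow> (\<And>i. i \<in> I \<Longrightarrow> smooth_vector_field_on M U (Y i)) \<Longrightarrow>
    smooth_vector_field_on M U (\<lambda>q. \<Sum>i\<in>I. Y i q)"
  by (induction I rule: infinite_finite_induct)
    (auto intro: smooth_vector_field_on_zero smooth_vector_field_on_add)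

lemma dir_deriv_cong:
  assumes "open U" "p \<in> U" "\<And>q. q \<in> U \<Longrightarrow> f q = h q"
    and "(f \<circ> chart_inv (chart_at M p)) differentiable (at (chart_map (chart_at M p) p))"
  shows "dir_deriv M f p v = dir_deriv M h p v"
proof -
  let ?c = "chart_at M p"
  have "frechet_derivative (f \<circ> chart_inv ?c) (at (chart_map ?c p)) =
      frechet_derivative (h \<circ> chart_inv ?c) (at (chart_map ?c p))"
    by (rule frechet_derivative_transform_within_open
        [OF assms(4) open_chart_image [OF chart_at(1) assms(1)]])
      (use assms in \<open>auto simp: chart_inv_chart_map\<close>)
  then show ?thesis by (simp add: dir_deriv_def)
qed

lemma vector_field_has_derivative:
  assumes "open U" "p \<in> U" "smooth_vector_field_on M U Y"
  shows "((\<lambda>q. to_chart M (chart_at M p) q (Y q)) \<circ> chart_inv (chart_at M p) has_derivative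
      dir_deriv M (\<lambda>q. to_chart M (chart_at M p) q (Y q)) p) (at (chart_map (chart_at M p) p))"
proof -
  have "smooth_on (chart_map (chart_at M p) ` (chart_dom (chart_at M p) \<inter> U))
      ((\<lambda>q. to_chart M (chart_at M p) q (Y q)) \<circ> chart_inv (chart_at M p))"
    using assms(3) by (simp add: smooth_vector_field_on_def)
  then show ?thesis
    unfolding dir_deriv_def
    by (rule has_frechet_derivative [OF smooth_on_differentiable]) (use assms in auto)
qed

end

text \<open>The Christoffel symbols at \<open>p\<close>, contracted with \<open>v\<close> and
  \<open>w\<close>: the differentiated field has constant components \<open>w\<close> in the chosen
  chart at \<open>p\<close>.\<close>

definition christoffel ::
    "('a, 'e::euclidean_space) manifold \<Rightarrow> ('a \<Rightarrow> 'e \<Rightarrow> ('a \<Rightarrow> 'e) \<Rightarrow> 'e) \<Rightarrow> 'a \<Rightarrow> 'e \<Rightarrow> 'e \<Rightarrow> 'e" where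
  "christoffel M nab p v w = nab p v (\<lambda>q. from_chart M (chart_at M p) q w)"

context levi_civita_connection
begin

text \<open>Multiplying by the indicator function of \<open>U\<close>, which is smooth on \<open>U\<close>, turns fields that
  agree on \<open>U\<close> into equal ones.\<close>

lemma connection_cong:
  assumes U: "open U" "p \<in> U" and Y: "smooth_vector_field_on M U Y"
    and eq: "\<And>q. q \<in> U \<Longrightarrow> Y q = Z q"
  shows "nab p v Y = nab p v Z"
proof -
  define f :: "'a \<Rightarrow> real" where "f = indicator U"
  have f: "smooth_fun_on M U f"
    unfolding smooth_fun_on_def
    by (intro ballI, rule smooth_on_cong [OF smooth_on_const [of _ 1]])
      (auto simp: f_def chart_inv_chart_map intro: open_chart_image U)
  have df: "dir_deriv M f p v = 0"
    using dir_deriv_cong [OF U, of "\<lambda>q. 1" f v] by (simp add: f_def comp_def)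
  have eq': "(\<lambda>q. f q *\<^sub>R Y q) = (\<lambda>q. f q *\<^sub>R Z q)"
    by (auto simp: f_def eq split: split_indicator)
  have "nab p v (\<lambda>q. f q *\<^sub>R X q) = nab p v X" if "smooth_vector_field_on M U X" for X
    using connection_Leibniz [OF U f that] U by (simp add: df) (simp add: f_def)
  with eq' Y smooth_vector_field_on_cong [OF U(1) Y eq] show ?thesis
    by metis
qed

lemma connection_scaleR:
  assumes "open U" "p \<in> U" "smooth_vector_field_on M U Y"
  shows "nab p v (\<lambda>q. a *\<^sub>R Y q) = a *\<^sub>R nab p v Y"
  using connection_Leibniz [OF assms(1,2) smooth_fun_on_const assms(3), of v a] by simp

lemma connection_sum:
  assumes U: "open U" "p \<in> U" and "\<And>i. i \<in> I \<Longrightarrow> smooth_vector_field_on M U (Y i)"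
  shows "nab p v (\<lambda>q. \<Sum>i\<in>I. Y i q) = (\<Sum>i\<in>I. nab p v (Y i))"
proof -
  have zero: "nab p v (\<lambda>q. 0) = 0"
    using connection_scaleR [OF U smooth_vector_field_on_zero [OF U(1)], of v 0] by simp
  show ?thesis
    using assms(3)
  proof (induction I rule: infinite_finite_induct)
    case (insert i I)
    then have "nab p v (\<lambda>q. Y i q + (\<Sum>i\<in>I. Y i q)) = nab p v (Y i) + nab p v (\<lambda>q. \<Sum>i\<in>I. Y i q)"
      by (intro connection_add [OF U] smooth_vector_field_on_sum U) auto
    with insert show ?case by simp
  qed (simp_all add: zero)
qed

lemma coordinate_field:
  "smooth_vector_field_on M (chart_dom (chart_at M p)) (\<lambda>q. from_chart M (chart_at M p) q w)"
  by (intro smooth_vector_field_on_from_chart chart_at)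

lemma linear_christoffel_left: "linear (\<lambda>v. christoffel M nab p v w)"
  unfolding christoffel_def
  by (rule connection_linear [OF open_chart_dom [OF chart_at(1)] chart_at(2) coordinate_field])

text \<open>\<open>from_chart\<close> is known to be linear only over the chart domain, so the
  fields are compared there by \<open>connection_cong\<close>.\<close>

lemma linear_christoffel_right: "linear (christoffel M nab p v)"
proof
  let ?c = "chart_at M p"
  note U = open_chart_dom [OF chart_at(1)] chart_at(2) [of p]
  fix w w' :: 'e and a :: real
  have "nab p v (\<lambda>q. from_chart M ?c q (w + w'))
      = nab p v (\<lambda>q. from_chart M ?c q w + from_chart M ?c q w')"
    by (rule connection_cong [OF U coordinate_field]) (simp add: linear_add [OF linear_from_chart])
  then show "christoffel M nab p v (w + w') = christoffel M nab p v w + christoffel M nab p v w'"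
    unfolding christoffel_def by (simp add: connection_add [OF U coordinate_field coordinate_field])
  have "nab p v (\<lambda>q. from_chart M ?c q (a *\<^sub>R w)) = nab p v (\<lambda>q. a *\<^sub>R from_chart M ?c q w)"
    by (rule connection_cong [OF U coordinate_field]) (simp add: linear_cmul [OF linear_from_chart])
  then show "christoffel M nab p v (a *\<^sub>R w) = a *\<^sub>R christoffel M nab p v w"
    unfolding christoffel_def by (simp add: connection_scaleR [OF U coordinate_field])
qed

text \<open>Coordinate fields have constant components near \<open>p\<close>, so their Lie bracket
  vanishes at \<open>p\<close>, and the connection has no torsion.\<close>

lemma christoffel_symmetric: "christoffel M nab p v w = christoffel M nab p w v"
proof -
  let ?c = "chart_at M p"
  note U = open_chart_dom [OF chart_at(1)] chart_at(2) [of p]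
  have "dir_deriv M (\<lambda>q. to_chart M ?c q (from_chart M ?c q u)) p u' = 0" for u u'
    using dir_deriv_cong [OF U, of "\<lambda>q. u" "\<lambda>q. to_chart M ?c q (from_chart M ?c q u)" u']
    by (simp add: comp_def)
  then show ?thesis
    using torsion_free [OF U coordinate_field [of p v] coordinate_field [of p w]]
    by (simp add: christoffel_def lie_bracket_def)
qed

text \<open>Near \<open>p\<close> the field is a combination of coordinate fields with smooth
  coefficients, to which additivity and the Leibniz rule apply.\<close>

lemma connection_coordinates:
  assumes U: "open U" "p \<in> U" and Y: "smooth_vector_field_on M U Y"
  shows "nab p v Y = dir_deriv M (\<lambda>q. to_chart M (chart_at M p) q (Y q)) p v + christoffel M nab p v (Y p)"
proof -
  let ?c = "chart_at M p" and ?V = "U \<inter> chart_dom (chart_at M p)"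
  let ?y = "\<lambda>q. to_chart M ?c q (Y q)"
  have V: "open ?V" "p \<in> ?V"
    using U by (auto intro: open_chart_dom chart_at(1))
  have YV: "smooth_vector_field_on M ?V Y"
    by (rule smooth_vector_field_on_mono [OF Y]) auto
  have X: "smooth_vector_field_on M ?V (\<lambda>q. from_chart M ?c q b)" for b
    by (rule smooth_vector_field_on_mono [OF coordinate_field]) auto
  have y: "smooth_fun_on M ?V (\<lambda>q. ?y q \<bullet> b)" for b
    by (rule smooth_fun_on_to_chart [OF chart_at(1) _ V(1) YV]) auto
  have "nab p v Y = nab p v (\<lambda>q. \<Sum>b\<in>Basis. (?y q \<bullet> b) *\<^sub>R from_chart M ?c q b)"
  proof (rule connection_cong [OF V YV])
    fix q assume q: "q \<in> ?V"
    then have "Y q = from_chart M ?c q (?y q)" by simp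
    also have "\<dots> = (\<Sum>b\<in>Basis. (?y q \<bullet> b) *\<^sub>R from_chart M ?c q b)"
      using q by (intro linear_euclidean_sum linear_from_chart) auto
    finally show "Y q = (\<Sum>b\<in>Basis. (?y q \<bullet> b) *\<^sub>R from_chart M ?c q b)" .
  qed
  also have "\<dots> = (\<Sum>b\<in>Basis. nab p v (\<lambda>q. (?y q \<bullet> b) *\<^sub>R from_chart M ?c q b))"
    by (rule connection_sum [OF V smooth_vector_field_on_scaleR [OF V(1) y X]])
  also have "\<dots> = (\<Sum>b\<in>Basis. dir_deriv M (\<lambda>q. ?y q \<bullet> b) p v *\<^sub>R b
      + (Y p \<bullet> b) *\<^sub>R christoffel M nab p v b)"
    by (simp add: connection_Leibniz [OF V y X] christoffel_def)
  also have "\<dots> = (\<Sum>b\<in>Basis. (dir_deriv M ?y p v \<bullet> b) *\<^sub>R b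
      + (Y p \<bullet> b) *\<^sub>R christoffel M nab p v b)"
  proof -
    have "dir_deriv M (\<lambda>q. ?y q \<bullet> b) p v = dir_deriv M ?y p v \<bullet> b" for b
      using frechet_derivative_eqI [OF has_derivative_inner_left [OF vector_field_has_derivative [OF U Y]]]
      unfolding dir_deriv_def [of _ "\<lambda>q. ?y q \<bullet> b"] by (simp add: comp_def)
    then show ?thesis by simp
  qed
  also have "\<dots> = dir_deriv M ?y p v + christoffel M nab p v (Y p)"
    by (simp add: sum.distrib euclidean_representation
        linear_euclidean_sum [OF linear_christoffel_right, symmetric])
  finally show ?thesis .
qed

end

text \<open>For a coordinate field, \<open>phi_parallel\<close> becomes a formula for the derivative
  of the matrix of \<phi> in the chart, namely its commutator with the Christoffel matrix.\<close>

lemma (in cosymplectic_manifold) phi_has_derivative: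
  fixes p :: 'a and w :: 'e
  defines "c \<equiv> chart_at M p"
  shows "((\<lambda>q. to_chart M c q (\<phi> q (from_chart M c q w))) \<circ> chart_inv c has_derivative
    (\<lambda>u. \<phi> p (christoffel M nab p u w) - christoffel M nab p u (\<phi> p w))) (at (chart_map c p))"
proof -
  note U = open_chart_dom [OF chart_at(1)] chart_at(2) [of p]
  note sm = phi_smooth [OF U(1) coordinate_field [of p w]]
  have "dir_deriv M (\<lambda>q. to_chart M c q (\<phi> q (from_chart M c q w))) p u
      = \<phi> p (christoffel M nab p u w) - christoffel M nab p u (\<phi> p w)" for u
    using connection_coordinates [OF U sm, of u] phi_parallel [OF U coordinate_field [of p w], of u]
    by (simp add: c_def christoffel_def eq_diff_eq)
  then show ?thesis
    using vector_field_has_derivative [OF U sm] unfolding c_def by presburger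
qed

section \<open>Second fundamental forms in coordinates\<close>

definition second_derivative ::
    "('a::real_normed_vector \<Rightarrow> 'b::real_normed_vector) \<Rightarrow> 'a \<Rightarrow> 'a \<Rightarrow> 'a \<Rightarrow> 'b" where
  "second_derivative f x v w = frechet_derivative (\<lambda>y. frechet_derivative f (at y) w) (at x) v"

lemma smooth_on_second_derivative:
  fixes f :: "'a::real_normed_vector \<Rightarrow> 'b::euclidean_space"
  assumes "smooth_on S f" "x \<in> S"
  shows "((\<lambda>y. frechet_derivative f (at y) w) has_derivative (\<lambda>v. second_derivative f x v w)) (at x)"
  unfolding second_derivative_def
  by (rule has_frechet_derivative smooth_on_differentiable smooth_on_frechet_derivative assms)+

text \<open>The part of the covariant derivative of \<open>\<lambda>q. differential M N F q (Y q)\<close> along \<open>v\<close> that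
  depends on \<open>Y\<close> only through its value \<open>w\<close>.\<close>

definition coordinate_second_form ::
    "('a, 'e::euclidean_space) manifold \<Rightarrow> ('b, 'f::euclidean_space) manifold \<Rightarrow>
     ('b \<Rightarrow> 'f \<Rightarrow> ('b \<Rightarrow> 'f) \<Rightarrow> 'f) \<Rightarrow> ('a \<Rightarrow> 'b) \<Rightarrow> 'a \<Rightarrow> 'e \<Rightarrow> 'e \<Rightarrow> 'f" where
  "coordinate_second_form M N nab F p v w =
     second_derivative (chart_map (chart_at N (F p)) \<circ> F \<circ> chart_inv (chart_at M p))
       (chart_map (chart_at M p) p) v w +
     christoffel N nab (F p) (differential M N F p v) (differential M N F p w)"

locale smooth_map_to_connection =
  source: smooth_manifold M + target: levi_civita_connection N g' nab
  for M :: "('a::{t2_space,second_countable_topology}, 'e::euclidean_space) manifold"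
    and N :: "('b::{t2_space,second_countable_topology}, 'f::euclidean_space) manifold"
    and g' :: "'b \<Rightarrow> 'f \<Rightarrow> 'f \<Rightarrow> real"
    and nab :: "'b \<Rightarrow> 'f \<Rightarrow> ('b \<Rightarrow> 'f) \<Rightarrow> 'f" +
  fixes F :: "'a \<Rightarrow> 'b"
  assumes F: "smooth_map M N F"
begin

abbreviation local_repr :: "'a \<Rightarrow> 'e \<Rightarrow> 'f" where
  "local_repr p \<equiv> chart_map (chart_at N (F p)) \<circ> F \<circ> chart_inv (chart_at M p)"

abbreviation local_dom :: "'a \<Rightarrow> 'a set \<Rightarrow> 'e set" where
  "local_dom p U \<equiv> chart_map (chart_at M p) `
     (chart_dom (chart_at M p) \<inter> (U \<inter> F -` chart_dom (chart_at N (F p))))"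

lemma open_local_dom: "open U \<Longrightarrow> open (local_dom p U)"
proof -
  assume "open U"
  moreover have "open (F -` chart_dom (chart_at N (F p)))"
    using F target.open_chart_dom [OF target.chart_at(1)]
    by (auto simp: smooth_map_def intro: open_vimage)
  ultimately show ?thesis
    by (intro source.open_chart_image source.chart_at open_Int)
qed

lemma in_local_dom: "p \<in> U \<Longrightarrow> chart_map (chart_at M p) p \<in> local_dom p U"
  by simp

lemma smooth_local_repr: "smooth_on (local_dom p U) (local_repr p)"
proof (rule smooth_on_mono)
  show "smooth_on (chart_map (chart_at M p) `
     (chart_dom (chart_at M p) \<inter> F -` chart_dom (chart_at N (F p)))) (local_repr p)"
    using F by (simp add: smooth_map_def)
qed auto

lemma differential_eq:
  "differential M N F p = frechet_derivative (local_repr p) (at (chart_map (chart_at M p) p))"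
  by (auto simp: differential_def)

lemma linear_local_repr:
  "y \<in> local_dom p U \<Longrightarrow> linear (frechet_derivative (local_repr p) (at y))"
  by (rule linear_frechet_derivative [OF smooth_on_differentiable [OF smooth_local_repr]])

lemma linear_differential: "linear (differential M N F p)"
  unfolding differential_eq using linear_local_repr [OF in_local_dom [OF UNIV_I]] .

lemma local_repr_has_derivative:
  "((\<lambda>y. frechet_derivative (local_repr p) (at y) w) has_derivative
    (\<lambda>v. second_derivative (local_repr p) (chart_map (chart_at M p) p) v w))
    (at (chart_map (chart_at M p) p))"
  by (rule smooth_on_second_derivative [OF smooth_local_repr in_local_dom [OF UNIV_I]])

text \<open>Mixed second derivatives agree, and the Christoffel term is symmetric by vanishing
  torsion.\<close>

lemma coordinate_second_form_symmetric:
  "coordinate_second_form M N nab F p v w = coordinate_second_form M N nab F p w v"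
proof -
  have "second_derivative (local_repr p) (chart_map (chart_at M p) p) v w
      = second_derivative (local_repr p) (chart_map (chart_at M p) p) w v"
    by (rule second_derivative_symmetric [OF open_local_dom [OF open_UNIV] in_local_dom
          smooth_on_differentiable [OF smooth_local_repr] local_repr_has_derivative
          local_repr_has_derivative]) auto
  then show ?thesis
    by (simp add: coordinate_second_form_def target.christoffel_symmetric [of "F p"])
qed

text \<open>Linearity is immediate in the direction of differentiation, the first argument; symmetry
  carries it to the second.\<close>

lemma linear_coordinate_second_form: "linear (coordinate_second_form M N nab F p v)"
proof -
  have "linear (\<lambda>v. coordinate_second_form M N nab F p v w)" for w
    unfolding coordinate_second_form_def
    using has_derivative_linear [OF local_repr_has_derivative]
      linear_compose [OF linear_differential target.linear_christoffel_left]
    by (auto intro: linear_compose_add simp: comp_def)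
  then show ?thesis
    by (subst (asm) coordinate_second_form_symmetric)
qed

text \<open>The product rule splits the derivative of dF (Y) into the second derivative of F and dF
  applied to the derivative of the components of Y. The latter is tangent, so the normal part sees
  only the pointwise form.\<close>

lemma covariant_deriv_along_differential:
  assumes U: "open U" "p \<in> U" and Y: "smooth_vector_field_on M U Y"
  shows "covariant_deriv_along M N nab F p v (\<lambda>q. differential M N F q (Y q))
    - coordinate_second_form M N nab F p v (Y p) \<in> range (differential M N F p)"
proof -
  let ?c = "chart_at M p" and ?d = "chart_at N (F p)"
  let ?x = "chart_map ?c p"
  let ?E = "(\<lambda>q. to_chart M ?c q (Y q)) \<circ> chart_inv ?c"
  let ?W = "\<lambda>q. to_chart N ?d (F q) (differential M N F q (Y q))"
  note S = open_local_dom [OF U(1), of p] in_local_dom [OF U(2)]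
  have E: "?E ?x = Y p"
    by (simp add: source.chart_inv_chart_map)
  have "((\<lambda>y. frechet_derivative (local_repr p) (at y) (?E y)) has_derivative
      (\<lambda>v. frechet_derivative (local_repr p) (at ?x)
        (dir_deriv M (\<lambda>q. to_chart M ?c q (Y q)) p v)
      + second_derivative (local_repr p) ?x v (?E ?x))) (at ?x)"
    by (rule has_derivative_apply_linear [OF local_repr_has_derivative
          source.vector_field_has_derivative [OF U Y] linear_local_repr S])
  then have "(?W \<circ> chart_inv ?c has_derivative
      (\<lambda>v. frechet_derivative (local_repr p) (at ?x)
        (dir_deriv M (\<lambda>q. to_chart M ?c q (Y q)) p v)
      + second_derivative (local_repr p) ?x v (Y p))) (at ?x)"
    unfolding E
  proof (rule has_derivative_transform_within_open [OF _ S])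
    fix y assume "y \<in> local_dom p U"
    then obtain q where q: "y = chart_map ?c q" "q \<in> chart_dom ?c" "F q \<in> chart_dom ?d"
      by auto
    have "?W q = frechet_derivative (local_repr p) (at (chart_map ?c q)) (to_chart M ?c q (Y q))"
      by (rule to_chart_differential [OF source.smooth_manifold_axioms target.smooth_manifold_axioms F
            source.chart_at(1) q(2) target.chart_at(1) q(3)])
    then show "frechet_derivative (local_repr p) (at y) (?E y) = (?W \<circ> chart_inv ?c) y"
      using q by (simp add: source.chart_inv_chart_map)
  qed
  then have "dir_deriv M ?W p v = differential M N F p (dir_deriv M (\<lambda>q. to_chart M ?c q (Y q)) p v)
      + second_derivative (local_repr p) ?x v (Y p)"
    unfolding dir_deriv_def [of _ ?W] differential_eq [of p]
    by (rule fun_cong [OF frechet_derivative_eqI])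
  then show ?thesis
    by (simp add: covariant_deriv_along_def coordinate_second_form_def christoffel_def Let_def)
qed

end

text \<open>The tangential part \<open>L t\<close> solves the normal equations. Their Gram operator
  \<open>\<Psi>\<close> is injective by positive definiteness, hence surjective in finite
  dimension.\<close>

lemma riemannian_orthogonal_decomposition:
  fixes L :: "'a::euclidean_space \<Rightarrow> 'b::real_vector"
  assumes G: "bilinear G" "\<And>v. v \<noteq> 0 \<Longrightarrow> G v v > (0::real)" and L: "linear L" "inj L"
  shows "\<exists>!n. (\<forall>v. G n (L v) = 0) \<and> u - n \<in> range L"
proof -
  note [simp] = bilinear_ladd [OF G(1)] bilinear_lsub [OF G(1)] bilinear_lmul [OF G(1)]
    bilinear_radd [OF G(1)] bilinear_rmul [OF G(1)] bilinear_lzero [OF G(1)] bilinear_rzero [OF G(1)]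
  define \<Psi> where "\<Psi> v = (\<Sum>b\<in>Basis. G (L v) (L b) *\<^sub>R b)" for v
  have lin_r: "linear (\<lambda>w. G u (L w))" for u
    by (rule linearI) (simp_all add: linear_add [OF L(1)] linear_cmul [OF L(1)])
  have \<Psi>: "\<Psi> v \<bullet> w = G (L v) (L w)" for v w
    using linear_euclidean_sum [OF lin_r, of "L v" w]
    by (simp add: \<Psi>_def inner_sum_left inner_commute [of w] mult.commute)
  have "linear \<Psi>"
    unfolding \<Psi>_def
    by (rule linearI) (simp_all add: linear_add [OF L(1)] linear_cmul [OF L(1)] sum.distrib
        scaleR_add_left scaleR_sum_right)
  moreover have "v = 0" if "\<Psi> v = 0" for v
  proof -
    have "G (L v) (L v) = 0" using \<Psi> [of v v] that by simp
    then have "L v = 0" using G(2) [of "L v"] by force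
    then show ?thesis using L linear_injective_0 by blast
  qed
  ultimately have "surj \<Psi>"
    using linear_injective_0 linear_injective_imp_surjective by blast
  then obtain t where t: "\<Psi> t = (\<Sum>b\<in>Basis. G u (L b) *\<^sub>R b)" by (metis surjD)
  have "G (L t) (L w) = G u (L w)" for w
  proof -
    have "(\<Sum>b\<in>Basis. G u (L b) *\<^sub>R b) \<bullet> w = G u (L w)"
      using linear_euclidean_sum [OF lin_r, of u w]
      by (simp add: inner_sum_left inner_commute [of w] mult.commute)
    then show ?thesis using \<Psi> [of t w] t by simp
  qed
  then have ex: "\<forall>v. G (u - L t) (L v) = 0" "u - (u - L t) \<in> range L" by auto
  have "n = n'" if n: "\<forall>v. G n (L v) = 0" "u - n \<in> range L"
    and n': "\<forall>v. G n' (L v) = 0" "u - n' \<in> range L" for n n'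
  proof -
    obtain v v' where "u - n = L v" "u - n' = L v'" using n n' by auto
    then have "n - n' = L (v' - v)" by (simp add: linear_diff [OF L(1)] algebra_simps)
    moreover have "G (n - n') (L (v' - v)) = 0" using n n' by simp
    ultimately show ?thesis using G(2) [of "n - n'"] by fastforce
  qed
  with ex show ?thesis by (intro ex1I [of _ "u - L t"]) auto
qed

locale riemannian_immersion = smooth_map_to_connection +
  assumes immersion: "inj (differential M N F p)"
begin

text \<open>Guarantees that the definite description in \<open>normal_part\<close> denotes.\<close>

lemma normal_part_ex1: "\<exists>!n. n \<in> normal_space M N g' F p \<and> u - n \<in> range (differential M N F p)"
  using riemannian_orthogonal_decomposition [OF target.metric_bilinear target.metric_pos
      linear_differential immersion]
  by (simp add: normal_space_def)

lemma normal_part_works: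
  "normal_part M N g' F p u \<in> normal_space M N g' F p"
  "u - normal_part M N g' F p u \<in> range (differential M N F p)"
  using theI' [OF normal_part_ex1 [of p u]] by (simp_all add: normal_part_def)

lemma normal_part_eqI:
  "n \<in> normal_space M N g' F p \<Longrightarrow> u - n \<in> range (differential M N F p) \<Longrightarrow> normal_part M N g' F p u = n"
  unfolding normal_part_def by (rule the1_equality [OF normal_part_ex1]) simp

lemma subspace_tangent: "subspace (range (differential M N F p))"
  by (intro linear_subspace_image linear_differential subspace_UNIV)

lemma normal_part_tangent: "u \<in> range (differential M N F p) \<Longrightarrow> normal_part M N g' F p u = 0"
  by (rule normal_part_eqI)
    (simp_all add: normal_space_def bilinear_lzero [OF target.metric_bilinear])

lemma normal_part_add:
  "normal_part M N g' F p (u + u') = normal_part M N g' F p u + normal_part M N g' F p u'"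
proof (rule normal_part_eqI)
  show "normal_part M N g' F p u + normal_part M N g' F p u' \<in> normal_space M N g' F p"
    using normal_part_works(1) [of p u] normal_part_works(1) [of p u']
    by (simp add: normal_space_def bilinear_ladd [OF target.metric_bilinear])
  show "u + u' - (normal_part M N g' F p u + normal_part M N g' F p u')
      \<in> range (differential M N F p)"
    using subspace_add [OF subspace_tangent normal_part_works(2) [of u p] normal_part_works(2) [of u' p]]
    by (simp add: algebra_simps)
qed

lemma normal_part_sum:
  "normal_part M N g' F p (\<Sum>i\<in>I. u i) = (\<Sum>i\<in>I. normal_part M N g' F p (u i))"
  by (induction I rule: infinite_finite_induct)
    (simp_all add: normal_part_add normal_part_tangent subspace_0 [OF subspace_tangent])

end

section \<open>Invariant submanifolds\<close>

text \<open>Apply \<open>metric_phi\<close> to \<open>\<phi> p v\<close> and \<open>w\<close>: both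
  terms containing \<eta> vanish because \<eta> annihilates the image of \<phi>.\<close>

lemma (in almost_contact_metric_manifold) phi_skew: "g p (\<phi> p v) w = - g p v (\<phi> p w)"
proof -
  note [simp] = bilinear_ladd [OF metric_bilinear] bilinear_lsub [OF metric_bilinear]
    bilinear_lmul [OF metric_bilinear]
  have "g p (\<phi> p v) w = g p (\<phi> p (\<phi> p v)) (\<phi> p w)"
    by (simp add: metric_phi eta_phi)
  also have "\<dots> = - g p v (\<phi> p w)"
    using eta_phi [of p w] by (simp add: phi_phi eta_eq metric_sym [of p "\<xi> p"])
  finally show ?thesis .
qed

text \<open>Contracting the symmetric \<open>B\<close> with the antisymmetric matrix of \<open>\<phi>\<close> gives zero, so \<open>\<phi>\<close>
  maps the trace of \<open>B\<close> into \<open>R\<close>.\<close>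

lemma trace_in_subspace:
  fixes k :: nat
  assumes R: "subspace R" and \<phi>: "linear \<phi>" "\<And>u. u \<in> R \<Longrightarrow> \<phi> u \<in> R" "\<And>u. \<phi> (\<phi> u) + u \<in> R"
    and B: "\<And>v. linear (B v)" "\<And>v w. B v w = B w v"
    and a: "\<And>i j. a i j = - a j i"
    and mod: "\<And>i. i < k \<Longrightarrow> \<phi> (B (e i) (e i)) - B (e i) (\<Sum>j<k. a i j *\<^sub>R e j) \<in> R"
  shows "(\<Sum>i<k. B (e i) (e i)) \<in> R"
proof -
  define T where "T = (\<Sum>i<k. \<Sum>j<k. a i j *\<^sub>R B (e i) (e j))"
  have "T = (\<Sum>j<k. \<Sum>i<k. a i j *\<^sub>R B (e i) (e j))"
    unfolding T_def by (rule sum.swap)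
  also have "\<dots> = (\<Sum>j<k. \<Sum>i<k. - (a j i *\<^sub>R B (e j) (e i)))"
  proof (intro sum.cong refl)
    show "a i j *\<^sub>R B (e i) (e j) = - (a j i *\<^sub>R B (e j) (e i))" for i j
      unfolding a [of i j] B(2) [of "e i" "e j"] by simp
  qed
  also have "\<dots> = - T" by (simp add: T_def sum_negf)
  finally have "T + T = 0" by (simp add: eq_neg_iff_add_eq_0)
  then have "T = 0" by (simp flip: scaleR_2)
  moreover have "T = (\<Sum>i<k. B (e i) (\<Sum>j<k. a i j *\<^sub>R e j))"
    by (simp add: T_def linear_sum [OF B(1)] linear_cmul [OF B(1)])
  ultimately have "\<phi> (\<Sum>i<k. B (e i) (e i)) = (\<Sum>i<k. \<phi> (B (e i) (e i)) - B (e i) (\<Sum>j<k. a i j *\<^sub>R e j))"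
    by (simp add: linear_sum [OF \<phi>(1)] sum_subtractf)
  also have "\<dots> \<in> R" using mod by (intro subspace_sum R) auto
  finally have "\<phi> (\<Sum>i<k. B (e i) (e i)) \<in> R" .
  from subspace_diff [OF R \<phi>(3) \<phi>(2) [OF this]]
  have "\<phi> (\<phi> (\<Sum>i<k. B (e i) (e i))) + (\<Sum>i<k. B (e i) (e i))
      - \<phi> (\<phi> (\<Sum>i<k. B (e i) (e i))) \<in> R" .
  then show ?thesis by (simp only: add_diff_cancel_left')
qed

text \<open>The vectors satisfying the identity form a subspace that contains every
  \<open>e i\<close>.\<close>

lemma orthonormal_expansion:
  fixes k :: nat
  assumes G: "bilinear G" and ortho: "\<And>i j. i < k \<Longrightarrow> j < k \<Longrightarrow> G (e i) (e j) = (if i = j then 1 else 0 :: real)"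
    and u: "u \<in> span (e ` {..<k})"
  shows "u = (\<Sum>j<k. G u (e j) *\<^sub>R e j)"
proof -
  let ?V = "{u. u = (\<Sum>j<k. G u (e j) *\<^sub>R e j)}"
  have "subspace ?V"
    by (rule subspaceI)
      (auto simp: bilinear_lzero [OF G] bilinear_ladd [OF G] bilinear_lmul [OF G]
        scaleR_add_left sum.distrib scaleR_sum_right [symmetric] simp flip: scaleR_scaleR)
  moreover have "e i \<in> ?V" if "i < k" for i
  proof -
    have "(\<Sum>j<k. G (e i) (e j) *\<^sub>R e j) = (\<Sum>j<k. if j = i then e j else 0)"
      using ortho that by (intro sum.cong) auto
    also have "\<dots> = e i" using that by (subst sum.delta) auto
    finally show ?thesis by simp
  qed
  ultimately have "span (e ` {..<k}) \<subseteq> ?V"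
    by (intro span_minimal) auto
  with u show ?thesis by blast
qed

section \<open>The second form on the invariant factor\<close>

context contact_CR_warped_product_submanifold
begin

abbreviation P :: "('a \<times> 'b, 'e \<times> 'f) manifold" where
  "P \<equiv> prod_manifold NT NP"

lemma iota_immersion:
  assumes "cosymplectic_manifold M g \<phi> \<xi> \<eta> nab"
  shows "riemannian_immersion P M g nab \<iota>"
proof -
  interpret cosymplectic_manifold M g \<phi> \<xi> \<eta> nab by fact
  interpret P: smooth_manifold P
    by (rule smooth_manifold_prod_manifold) unfold_locales
  show ?thesis
    using immersed by unfold_locales (auto simp: isometric_immersion_def)
qed

text \<open>The invariance of \<open>N\<^sub>T\<close> gives \<open>\<phi> (d\<iota> (w, 0)) = d\<iota> (J w, 0)\<close> near every point; differentiate
  this identity and use that \<open>\<phi>\<close> is parallel.\<close>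

lemma coordinate_second_form_phi:
  assumes cosymp: "cosymplectic_manifold M g \<phi> \<xi> \<eta> nab"
    and z: "\<phi> (\<iota> x) (differential P M \<iota> x (w, 0)) = differential P M \<iota> x (z, 0)"
  shows "\<phi> (\<iota> x) (coordinate_second_form P M nab \<iota> x (v, 0) (w, 0))
    - coordinate_second_form P M nab \<iota> x (v, 0) (z, 0) \<in> differential P M \<iota> x ` fst_distribution x"
proof -
  interpret co: cosymplectic_manifold M g \<phi> \<xi> \<eta> nab by fact
  interpret im: riemannian_immersion P M g nab \<iota> by (rule iota_immersion [OF cosymp])
  define k where "k = chart_at M (\<iota> x)"
  define c where "c = chart_at P x"
  define F where "F = im.local_repr x"
  define y0 where "y0 = chart_map c x"
  \<comment> \<open>The differential of \<iota> at nearby points, restricted to the first factor of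
    the product chart; its range at \<open>y0\<close> is the subspace modulo which the claim
    holds.\<close>
  define A where "A y w = frechet_derivative F (at y) (w, 0)" for y and w :: 'e
  \<comment> \<open>The matrix of \<phi> in the fixed chart \<open>k\<close>, applied to constant
    components \<open>u\<close>.\<close>
  define \<Phi> where "\<Phi> u = (\<lambda>q. to_chart M k q (\<phi> q (from_chart M k q u))) \<circ> chart_inv k" for u
  define S where "S = im.local_dom x UNIV"
  let ?\<Gamma> = "christoffel M nab (\<iota> x)" and ?d = "differential P M \<iota> x"
  let ?D = "\<lambda>v w. second_derivative F y0 v (w, 0)"
  have k: "k \<in> atlas M" "\<iota> x \<in> chart_dom k" by (simp_all add: k_def)
  have S: "open S" "y0 \<in> S"
    unfolding S_def y0_def c_def by (rule im.open_local_dom [OF open_UNIV], rule im.in_local_dom, simp)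
  have dF: "?d = frechet_derivative F (at y0)"
    by (simp add: im.differential_eq F_def y0_def c_def)
  have F0: "F y0 = chart_map k (\<iota> x)"
    by (simp add: F_def y0_def c_def k_def im.source.chart_inv_chart_map)
  have Fder: "(F has_derivative ?d) (at y0)"
    unfolding dF F_def using S(2) unfolding S_def
    by (rule has_frechet_derivative [OF smooth_on_differentiable [OF im.smooth_local_repr]])
  have A_der: "((\<lambda>y. A y w) has_derivative (\<lambda>v. ?D v w)) (at y0)" for w
    unfolding A_def F_def y0_def c_def by (rule im.local_repr_has_derivative)
  have A0: "A y0 w = ?d (w, 0)" for w by (simp add: A_def dF)
  have A_lin: "linear (A y)" if "y \<in> S" for y
  proof -
    have "linear (\<lambda>w. (w, 0) :: 'e \<times> 'f)" by (rule linearI) auto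
    from linear_compose [OF this im.linear_local_repr, of y x UNIV] that show ?thesis
      by (simp add: A_def [abs_def] F_def S_def comp_def)
  qed
  have A_inj: "inj (A y0)"
    using im.immersion [of x] by (auto simp: inj_def A0)
  have \<Phi>0: "\<Phi> u (F y0) = \<phi> (\<iota> x) u" for u
    by (simp add: \<Phi>_def F0 k_def ambient.chart_inv_chart_map)
  have \<Phi>F: "\<Phi> u (F y) = to_chart M k (\<iota> q) (\<phi> (\<iota> q) (from_chart M k (\<iota> q) u))"
    if "y = chart_map c q" "q \<in> chart_dom c" "\<iota> q \<in> chart_dom k" for u y q
    using that by (simp add: \<Phi>_def F_def c_def k_def im.source.chart_inv_chart_map ambient.chart_inv_chart_map)
  have S_point: "\<exists>q. y = chart_map c q \<and> q \<in> chart_dom c \<and> \<iota> q \<in> chart_dom k" if "y \<in> S" for y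
    using that by (auto simp: S_def c_def k_def)
  have \<Phi>_lin: "linear (\<lambda>u. \<Phi> u (F y))" if y: "y \<in> S" for y
  proof -
    obtain q where q: "y = chart_map c q" "q \<in> chart_dom c" "\<iota> q \<in> chart_dom k"
      using S_point [OF y] by blast
    have "linear (to_chart M k (\<iota> q) \<circ> \<phi> (\<iota> q) \<circ> from_chart M k (\<iota> q))"
      by (intro linear_compose ambient.linear_to_chart ambient.linear_from_chart ambient.phi_linear k q)
    then show ?thesis
      by (simp add: comp_def \<Phi>F [OF q])
  qed
  have \<Phi>_der: "((\<lambda>y. \<Phi> u (F y)) has_derivative
      (\<lambda>v. \<phi> (\<iota> x) (?\<Gamma> (?d v) u) - ?\<Gamma> (?d v) (\<phi> (\<iota> x) u))) (at y0)" for u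
    using has_derivative_compose [OF Fder, of "\<Phi> u" "\<lambda>v. \<phi> (\<iota> x) (?\<Gamma> v u) - ?\<Gamma> v (\<phi> (\<iota> x) u)"]
      co.phi_has_derivative [of "\<iota> x" u]
    by (simp only: F0 \<Phi>_def k_def)
  have h_der: "((\<lambda>y. \<Phi> (A y w) (F y)) has_derivative
      (\<lambda>v. \<Phi> (?D v w) (F y0) + (\<phi> (\<iota> x) (?\<Gamma> (?d v) (A y0 w)) - ?\<Gamma> (?d v) (\<phi> (\<iota> x) (A y0 w))))) (at y0)"
    by (rule has_derivative_apply_linear [OF \<Phi>_der A_der \<Phi>_lin S])
  \<comment> \<open>Invariance at the nearby point, rewritten in the fixed charts; a product chart
    keeps the second component zero in both directions of the translation.\<close>
  have range: "\<Phi> (A y w) (F y) \<in> range (A y)" if y: "y \<in> S" for y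
  proof -
    obtain q where q: "y = chart_map c q" "q \<in> chart_dom c" "\<iota> q \<in> chart_dom k"
      using S_point [OF y] by blast
    obtain q1 q2 where q12: "q = (q1, q2)" by (cases q)
    obtain x1 x2 where x: "x = (x1, x2)" by (cases x)
    have c: "c = prod_chart (chart_at NT x1) (chart_at NP x2)"
      by (simp add: c_def x)
    have q': "q1 \<in> chart_dom (chart_at NT x1)" "q2 \<in> chart_dom (chart_at NP x2)"
      using q(2) by (simp_all add: c q12)
    note mf = NT.smooth_manifold_axioms NP.smooth_manifold_axioms
    note pr = mf NT.chart_at(1) q'(1) NP.chart_at(1) q'(2)
    have "c \<in> atlas P" by (simp add: c_def)
    note td = to_chart_differential [OF im.source.smooth_manifold_axioms ambient.smooth_manifold_axioms
        im.F \<open>c \<in> atlas P\<close> q(2) k(1) q(3)]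
    have F_eq: "F = chart_map k \<circ> \<iota> \<circ> chart_inv c" by (simp add: F_def k_def c_def)
    have "from_chart P c q (w, 0) \<in> fst_distribution q"
      by (simp add: c q12 from_chart_prod_chart [OF pr] fst_distribution_def
          linear_0 [OF NP.linear_from_chart [OF NP.chart_at(1) q'(2)]])
    then have "\<phi> (\<iota> q) (differential P M \<iota> q (from_chart P c q (w, 0)))
        \<in> differential P M \<iota> q ` fst_distribution q"
      using invariant [of q] by blast
    then obtain w' where w': "\<phi> (\<iota> q) (differential P M \<iota> q (from_chart P c q (w, 0)))
        = differential P M \<iota> q (w', 0)"
      by (auto simp: fst_distribution_def)
    have "A y w = to_chart M k (\<iota> q) (differential P M \<iota> q (from_chart P c q (w, 0)))"
      using td [of "from_chart P c q (w, 0)"] \<open>c \<in> atlas P\<close> q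
      by (simp add: A_def F_eq)
    then have "\<Phi> (A y w) (F y) = to_chart M k (\<iota> q) (differential P M \<iota> q (w', 0))"
      by (simp add: q(1) \<Phi>F [OF refl q(2,3)] k q(3) w')
    also have "\<dots> = frechet_derivative F (at y) (to_chart P c q (w', 0))"
      using td [of "(w', 0)"] q(1) by (simp add: F_eq)
    also have "to_chart P c q (w', 0) = (to_chart NT (chart_at NT x1) q1 w', 0)"
      by (simp add: c q12 to_chart_prod_chart [OF pr]
          linear_0 [OF NP.linear_to_chart [OF NP.chart_at(1) q'(2)]])
    finally show ?thesis by (simp add: A_def)
  qed
  have "\<Phi> (?D (v, 0) w) (F y0) + (\<phi> (\<iota> x) (?\<Gamma> (?d (v, 0)) (A y0 w))
      - ?\<Gamma> (?d (v, 0)) (\<phi> (\<iota> x) (A y0 w))) - ?D (v, 0) z \<in> range (A y0)"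
    by (rule derivative_in_range_modulo [OF S A_lin A_der A_inj h_der range])
      (simp_all add: \<Phi>0 A0 z)
  moreover have "range (A y0) = ?d ` fst_distribution x"
    by (auto simp: A0 fst_distribution_def image_iff)
  moreover have "coordinate_second_form P M nab \<iota> x v w = second_derivative F y0 v w + ?\<Gamma> (?d v) (?d w)"
    for v w unfolding F_def y0_def c_def by (rule coordinate_second_form_def)
  \<comment> \<open>By \<open>z\<close>, the subtracted term
    \<open>?\<Gamma> (?d (v, 0)) (\<phi> (\<iota> x) (A y0 w))\<close> is the Christoffel part of
    the second form at \<open>(z, 0)\<close>.\<close>
  ultimately show ?thesis
    by (simp add: \<Phi>0 A0 z linear_add [OF ambient.phi_linear] algebra_simps)
qed

end

theorem corollary3p1:
  fixes NT :: "('a::{t2_space,second_countable_topology}, 'e::euclidean_space) manifold"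
    and gT :: "'a \<Rightarrow> 'e \<Rightarrow> 'e \<Rightarrow> real"
    and NP :: "('b::{t2_space,second_countable_topology}, 'f::euclidean_space) manifold"
    and gP :: "'b \<Rightarrow> 'f \<Rightarrow> 'f \<Rightarrow> real"
    and f :: "'a \<Rightarrow> real"
    and M :: "('c::{t2_space,second_countable_topology}, 'd::euclidean_space) manifold"
    and g :: "'c \<Rightarrow> 'd \<Rightarrow> 'd \<Rightarrow> real"
    and nab :: "'c \<Rightarrow> 'd \<Rightarrow> ('c \<Rightarrow> 'd) \<Rightarrow> 'd"
    and \<phi> :: "'c \<Rightarrow> 'd \<Rightarrow> 'd" and \<xi> :: "'c \<Rightarrow> 'd" and \<eta> :: "'c \<Rightarrow> 'd \<Rightarrow> real"
    and \<iota> :: "'a \<times> 'b \<Rightarrow> 'c"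
  assumes "cosymplectic_manifold M g \<phi> \<xi> \<eta> nab"
    and "contact_CR_warped_product_submanifold NT gT NP gP M g \<phi> \<xi> \<eta> f \<iota>"
  shows "distribution_minimal (prod_manifold NT NP) (warped_metric gT f gP) M g nab \<iota>
    fst_distribution DIM('e)"
  unfolding distribution_minimal_def
proof (intro allI impI ballI)
  interpret cosymplectic_manifold M g \<phi> \<xi> \<eta> nab by fact
  interpret CR: contact_CR_warped_product_submanifold NT gT NP gP M g \<phi> \<xi> \<eta> f \<iota> by fact
  let ?P = "prod_manifold NT NP" and ?k = "DIM('e)"
  interpret im: riemannian_immersion ?P M g nab \<iota> by (rule CR.iota_immersion) fact
  fix U e x
  assume frame: "local_orthonormal_frame ?P (warped_metric gT f gP) fst_distribution ?k U e"
    and x: "x \<in> U"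
  let ?d = "differential ?P M \<iota> x" and ?B = "coordinate_second_form ?P M nab \<iota> x"
  let ?\<phi> = "\<phi> (\<iota> x)" and ?R = "differential ?P M \<iota> x ` fst_distribution x"
  have U: "open U" and sm: "\<And>i. i < ?k \<Longrightarrow> smooth_vector_field_on ?P U (e i)"
    and on: "\<And>i j. i < ?k \<Longrightarrow> j < ?k \<Longrightarrow>
      warped_metric gT f gP x (e i x) (e j x) = (if i = j then 1 else 0)"
    and sp: "span ((\<lambda>i. e i x) ` {..<?k}) = fst_distribution x"
    using frame x by (auto simp: local_orthonormal_frame_def)
  have D: "e i x \<in> fst_distribution x" if "i < ?k" for i
    unfolding sp [symmetric] using that by (intro span_base) auto
  then have fst: "e i x = (fst (e i x), 0)" if "i < ?k" for i
    using that by (force simp: fst_distribution_def prod_eq_iff)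
  have R: "subspace ?R"
    unfolding sp [symmetric] by (intro linear_subspace_image im.linear_differential subspace_span)
  \<comment> \<open>The matrix of \<phi> in the orthonormal frame, skew because \<phi> is.\<close>
  define a where "a i j = g (\<iota> x) (?\<phi> (?d (e i x))) (?d (e j x))" for i j
  have a: "a i j = - a j i" for i j
    unfolding a_def using phi_skew metric_sym by metis
  have iso: "g (\<iota> x) (?d v) (?d w) = warped_metric gT f gP x v w" for v w
    using CR.immersed unfolding isometric_immersion_def by blast
  have mod: "?\<phi> (?B (e i x) (e i x)) - ?B (e i x) (\<Sum>j<?k. a i j *\<^sub>R e j x) \<in> ?R"
    if i: "i < ?k" for i
  proof -
    have "?d (e i x) \<in> ?R" using D [OF i] by (rule imageI)
    then obtain z where z: "?\<phi> (?d (e i x)) = ?d (z, 0)"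
      using CR.invariant [of x] by (auto simp: fst_distribution_def)
    have "?d (z, 0) \<in> ?R" by (auto simp: fst_distribution_def)
    also have "?R = span ((\<lambda>i. ?d (e i x)) ` {..<?k})"
      unfolding sp [symmetric] using linear_span_image [OF im.linear_differential [of x], of "(\<lambda>i. e i x) ` {..<?k}"]
      by (simp add: image_image)
    \<comment> \<open>The images of the frame are orthonormal and span \<open>?R\<close>, so the
      vector expands with coefficients \<open>a i j\<close>; injectivity of the differential then
      pulls the expansion back to the frame.\<close>
    finally have "?d (z, 0) = (\<Sum>j<?k. g (\<iota> x) (?d (z, 0)) (?d (e j x)) *\<^sub>R ?d (e j x))"
      by (intro orthonormal_expansion metric_bilinear) (simp_all add: iso on)
    also have "\<dots> = ?d (\<Sum>j<?k. a i j *\<^sub>R e j x)"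
      by (simp add: a_def z linear_sum [OF im.linear_differential] linear_cmul [OF im.linear_differential])
    finally have "(z, 0) = (\<Sum>j<?k. a i j *\<^sub>R e j x)"
      using im.immersion [of x] by (simp add: inj_eq)
    then show ?thesis
      using CR.coordinate_second_form_phi [OF assms(1), of x "fst (e i x)" z "fst (e i x)"]
        z fst [OF i] by simp
  qed
  have "(\<Sum>i<?k. ?B (e i x) (e i x)) \<in> ?R"
  proof (rule trace_in_subspace [OF R phi_linear [of "\<iota> x"] _ _ _ _ a mod])
    show "?\<phi> u \<in> ?R" if "u \<in> ?R" for u using CR.invariant [of x] that by blast
    \<comment> \<open>The sum is a multiple of \<xi>, which is tangent to the first factor.\<close>
    show "?\<phi> (?\<phi> u) + u \<in> ?R" for u
      using subspace_scale [OF R CR.xi_tangent] by (simp add: phi_phi)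
    show "linear (?B v)" for v by (rule im.linear_coordinate_second_form)
    show "?B v w = ?B w v" for v w by (rule im.coordinate_second_form_symmetric)
  qed
  then have trace: "(\<Sum>i<?k. ?B (e i x) (e i x)) \<in> range ?d" by blast
  let ?C = "\<lambda>i. covariant_deriv_along ?P M nab \<iota> x (e i x) (\<lambda>q. differential ?P M \<iota> q (e i q))"
  \<comment> \<open>Passing from the pointwise form to the covariant derivatives of the frame fields
    costs only tangent vectors.\<close>
  have "(\<Sum>i<?k. ?C i - ?B (e i x) (e i x)) \<in> range ?d"
    by (intro subspace_sum im.subspace_tangent im.covariant_deriv_along_differential [OF U x sm]) auto
  from subspace_add [OF im.subspace_tangent this trace] have "(\<Sum>i<?k. ?C i) \<in> range ?d"
    by (simp add: sum_subtractf)
  then show "(\<Sum>i<?k. second_fundamental_form ?P M g nab \<iota> (e i) (e i) x) = 0"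
    using im.normal_part_tangent
    by (simp add: second_fundamental_form_def flip: im.normal_part_sum)
qed

end
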